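(* Let $A\in\mathbb{R}^{n\times n}$, $T>0$, $X_0,U\in\mathbb{A}_n$. For $N\in\mathbb{N}$ let $\tau=T/N$, $\epsilon_h=1-1/N^2$, $\epsilon_u=1-1/N$, and assume $\tau\in\mathbb{I}$ and $\tau\|A\|\le1$. Let $\mathcal{S}_i^N,\mathcal{V}_i^N,\mathcal{W}_i^N,\Lambda_i^N$ ($i\in\{0,\dots,N\}$) be defined by $\mathcal{S}_0^N=X_0$, $\mathcal{S}_i^N=\mathcal{H}(\tau,\mathcal{S}_{i-1}^N,\epsilon_h)$; $\mathcal{V}_0^N=\mathcal{I}(\tau,U,\epsilon_u)$, $\mathcal{V}_i^N=\mathcal{H}(\tau,\mathcal{V}_{i-1}^N,\epsilon_h)$; $\mathcal{W}_0^N=\{0\}$, $\mathcal{W}_i^N=\mathcal{W}_{i-1}^N+\mathcal{V}_{i-1}^N$; $\Lambda_i^N=\mathcal{S}_i^N+\mathcal{W}_i^N$. Then there exist constants $D_1,D_2,D_3,D_4\ge0$, independent of $N$, such that for every such $N$ and all $i\in\{0,\dots,N\}$: $\mathfrak{d}(\mathcal{S}_i^N,\mathcal{R}_h(i\tau))\le D_1\tau$, $\mathfrak{d}(\mathcal{W}_i^N,\mathcal{R}_u(i\tau))\le D_2\tau$, $\mathfrak{d}(\Lambda_i^N,\mathcal{R}(i\tau))\le D_3\tau$, and $\mathfrak{d}\bigl(\bigcup_{i=0}^N\Lambda_i^N,\mathcal{R}([0,T])\bigr)\le D_4\tau$.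
   Context: A norm $\|\cdot\|$ is fixed on each $\mathbb{R}^k$, $\mathbf{B}_k$ is its closed unit ball, matrices carry induced norms, $G^\dagger$ is the Moore–Penrose inverse, $\rho(A)$ the spectral radius. $\mathfrak{d}$ is the Hausdorff distance: $\mathfrak{d}(\Omega,\Gamma)=\inf\{\varepsilon>0:\Omega\subseteq\Gamma+\varepsilon\mathbf{B}_n,\ \Gamma\subseteq\Omega+\varepsilon\mathbf{B}_n\}$. $\mathbb{A}_n$ is the collection of sets $c+G\mathbf{B}_p$, $c\in\mathbb{R}^n$, $G\in\mathbb{R}^{n\times p}$, $\mathrm{rank}(G)=n$, each regarded with its representation $(c,G)$. Set-valued integral $\int_0^tF(s)W\,\mathrm{d}s=\bigcup_w\int_0^tF(s)w(s)\,\mathrm{d}s$ over measurable $w:[0,t]\to W$. $\mathcal{R}_h(t)=\mathrm{e}^{tA}X_0$, $\mathcal{R}_u(t)=\int_0^t\mathrm{e}^{sA}U\,\mathrm{d}s$, $\mathcal{R}(t)=\mathcal{R}_h(t)+\mathcal{R}_u(t)$, $\mathcal{R}([0,T])=\bigcup_{t\in[0,T]}\mathcal{R}(t)$. $\mathbb{I}=\{t\ge0:\int_0^t\mathrm{e}^{sA}\mathrm{d}s\text{ invertible}\}$. $\mathcal{L}(t,k)=\sum_{j=0}^{k-1}(tA)^j/j!$, $\mathcal{T}(t,k)=\sum_{j=0}^{k-1}t^{j+1}A^j/(j+1)!$, $\theta(r,k)=\sum_{j=k}^\infty r^j/j!$. For $\Omega=c+G\mathbf{B}_p$: $\lambda(t,\Omega,k)=\dfrac{1-\mathrm{e}^{t\|A\|}\theta(t\|A\|,k)\|G^\dagger\|\|c\|}{1+\mathrm{e}^{t\|A\|}\theta(t\|A\|,k)\|G^\dagger\|\|G\|}$;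 $k_{\min}(t)=\min\{k\in\mathbb{N}:\theta(t\rho(A),k)\mathrm{e}^{t\rho(A)}<1\}$; $\kappa(t,\Omega,\epsilon)=\min\{k\in\mathbb{N}: k\ge\max(k_{\min}(t),2),\ \lambda(t,\Omega,k)>\epsilon\}$; $\eta(t,\Omega,\epsilon)=\min\{k\in\mathbb{N}:\lambda(t,\Omega,k)>\epsilon,\ \mathcal{T}(t,k)\text{ invertible}\}$ ($t\in\mathbb{I}$). $\mathcal{H}(t,\Omega,\epsilon)=\mathcal{L}(t,\kappa)[c+\lambda(t,\Omega,\kappa)G\mathbf{B}_p]$ with $\kappa=\kappa(t,\Omega,\epsilon)$, represented with center $\mathcal{L}(t,\kappa)c$ and generator matrix $\lambda(t,\Omega,\kappa)\mathcal{L}(t,\kappa)G$; $\mathcal{I}(t,\Omega,\epsilon)=\mathcal{T}(t,\eta)[c+\lambda(t,\Omega,\eta)G\mathbf{B}_p]$ with $\eta=\eta(t,\Omega,\epsilon)$, represented with center $\mathcal{T}(t,\eta)c$ and generator matrix $\lambda(t,\Omega,\eta)\mathcal{T}(t,\eta)G$. *)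

theory Defs
  imports "HOL-Analysis.Analysis"
begin

(* Matrices are real^'k^'m (m rows, k columns); dimensions are finite types.
   The norms on the spaces involved are arbitrary norms, passed as parameters. *)

definition is_norm :: "('a::real_vector \<Rightarrow> real) \<Rightarrow> bool" where
  "is_norm f \<longleftrightarrow> (\<forall>x. 0 \<le> f x) \<and> (\<forall>x. f x = 0 \<longleftrightarrow> x = 0)
     \<and> (\<forall>a x. f (a *\<^sub>R x) = \<bar>a\<bar> * f x) \<and> (\<forall>x y. f (x + y) \<le> f x + f y)"

text \<open>Closed unit ball of a norm.\<close>
definition nball :: "('a::real_vector \<Rightarrow> real) \<Rightarrow> 'a set" where
  "nball nr = {x. nr x \<le> 1}"

text \<open>Induced (operator) norm of a matrix M : R^k -> R^m.\<close>
definition opnorm :: "(real^'m \<Rightarrow> real) \<Rightarrow> (real^'k \<Rightarrow> real) \<Rightarrow> real^'k^'m \<Rightarrow> real" where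
  "opnorm nm nk M = Sup {nm (M *v x) | x. nk x \<le> 1}"

text \<open>Hausdorff distance w.r.t. the norm nr.\<close>
definition hausd :: "(real^'n \<Rightarrow> real) \<Rightarrow> (real^'n) set \<Rightarrow> (real^'n) set \<Rightarrow> real" where
  "hausd nr \<Omega> \<Gamma> = Inf {\<epsilon>. \<epsilon> > 0 \<and>
      \<Omega> \<subseteq> {g + \<epsilon> *\<^sub>R b | g b. g \<in> \<Gamma> \<and> b \<in> nball nr} \<and>
      \<Gamma> \<subseteq> {w + \<epsilon> *\<^sub>R b | w b. w \<in> \<Omega> \<and> b \<in> nball nr}}"

definition msum :: "('a::plus) set \<Rightarrow> 'a set \<Rightarrow> 'a set" where
  "msum X Y = {x + y | x y. x \<in> X \<and> y \<in> Y}"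

fun matpow :: "real^'n^'n \<Rightarrow> nat \<Rightarrow> real^'n^'n" where
  "matpow M 0 = mat 1"
| "matpow M (Suc j) = M ** matpow M j"

definition mexp :: "real^'n^'n \<Rightarrow> real^'n^'n" where
  "mexp M = (\<Sum>j. (1 / fact j) *\<^sub>R matpow M j)"

text \<open>Moore--Penrose inverse (the unique matrix satisfying the Penrose equations).\<close>
definition pinv :: "real^'p^'n \<Rightarrow> real^'n^'p" where
  "pinv G = (THE X. G ** X ** G = G \<and> X ** G ** X = X \<and>
                    transpose (G ** X) = G ** X \<and> transpose (X ** G) = X ** G)"

text \<open>Spectral radius: largest modulus of a (complex) eigenvalue.\<close>
definition spec_rad :: "real^'n^'n \<Rightarrow> real" where
  "spec_rad A = Max {cmod z | z. det (mat z - (\<chi> i j. complex_of_real (A $ i $ j))) = 0}"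

text \<open>Zonotope-like set c + G B_p given by a representation (c,G).\<close>
definition zset :: "(real^'p \<Rightarrow> real) \<Rightarrow> (real^'n) \<times> (real^'p^'n) \<Rightarrow> (real^'n) set" where
  "zset np r = {fst r + snd r *v b | b. b \<in> nball np}"

definition Lmat :: "real^'n^'n \<Rightarrow> real \<Rightarrow> nat \<Rightarrow> real^'n^'n" where
  "Lmat A t k = (\<Sum>j<k. (1 / fact j) *\<^sub>R matpow (t *\<^sub>R A) j)"

definition Tmat :: "real^'n^'n \<Rightarrow> real \<Rightarrow> nat \<Rightarrow> real^'n^'n" where
  "Tmat A t k = (\<Sum>j<k. (t ^ (j + 1) / fact (j + 1)) *\<^sub>R matpow A j)"

definition theta :: "real \<Rightarrow> nat \<Rightarrow> real" where
  "theta r k = (\<Sum>j. r ^ (j + k) / fact (j + k))"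

definition lam :: "(real^'n \<Rightarrow> real) \<Rightarrow> (real^'p \<Rightarrow> real) \<Rightarrow> real^'n^'n \<Rightarrow> real
                    \<Rightarrow> (real^'n) \<times> (real^'p^'n) \<Rightarrow> nat \<Rightarrow> real" where
  "lam nn np A t r k =
     (let a = t * opnorm nn nn A; e = exp a * theta a k in
      (1 - e * opnorm np nn (pinv (snd r)) * nn (fst r)) /
      (1 + e * opnorm np nn (pinv (snd r)) * opnorm nn np (snd r)))"

definition kmin :: "real^'n^'n \<Rightarrow> real \<Rightarrow> nat" where
  "kmin A t = (LEAST k. theta (t * spec_rad A) k * exp (t * spec_rad A) < 1)"

definition kappa :: "(real^'n \<Rightarrow> real) \<Rightarrow> (real^'p \<Rightarrow> real) \<Rightarrow> real^'n^'n \<Rightarrow> real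
                    \<Rightarrow> (real^'n) \<times> (real^'p^'n) \<Rightarrow> real \<Rightarrow> nat" where
  "kappa nn np A t r \<epsilon> = (LEAST k. k \<ge> max (kmin A t) 2 \<and> lam nn np A t r k > \<epsilon>)"

definition eta :: "(real^'n \<Rightarrow> real) \<Rightarrow> (real^'p \<Rightarrow> real) \<Rightarrow> real^'n^'n \<Rightarrow> real
                    \<Rightarrow> (real^'n) \<times> (real^'p^'n) \<Rightarrow> real \<Rightarrow> nat" where
  "eta nn np A t r \<epsilon> = (LEAST k. lam nn np A t r k > \<epsilon> \<and> invertible (Tmat A t k))"

text \<open>Representations (center, generator matrix) of H(t,Omega,eps) and I(t,Omega,eps).\<close>
definition Hrep :: "(real^'n \<Rightarrow> real) \<Rightarrow> (real^'p \<Rightarrow> real) \<Rightarrow> real^'n^'n \<Rightarrow> real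
                    \<Rightarrow> real \<Rightarrow> (real^'n) \<times> (real^'p^'n) \<Rightarrow> (real^'n) \<times> (real^'p^'n)" where
  "Hrep nn np A t \<epsilon> r =
     (let k = kappa nn np A t r \<epsilon> in
      (Lmat A t k *v fst r, lam nn np A t r k *\<^sub>R (Lmat A t k ** snd r)))"

definition Irep :: "(real^'n \<Rightarrow> real) \<Rightarrow> (real^'p \<Rightarrow> real) \<Rightarrow> real^'n^'n \<Rightarrow> real
                    \<Rightarrow> real \<Rightarrow> (real^'n) \<times> (real^'p^'n) \<Rightarrow> (real^'n) \<times> (real^'p^'n)" where
  "Irep nn np A t \<epsilon> r =
     (let k = eta nn np A t r \<epsilon> in
      (Tmat A t k *v fst r, lam nn np A t r k *\<^sub>R (Tmat A t k ** snd r)))"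

text \<open>The set I of t with invertible integral of e^{sA} over [0,t].\<close>
definition Iset :: "real^'n^'n \<Rightarrow> real set" where
  "Iset A = {t. t \<ge> 0 \<and> invertible (integral {0..t} (\<lambda>s. mexp (s *\<^sub>R A)))}"

definition Rh :: "real^'n^'n \<Rightarrow> (real^'n) set \<Rightarrow> real \<Rightarrow> (real^'n) set" where
  "Rh A X0 t = (\<lambda>x. mexp (t *\<^sub>R A) *v x) ` X0"

definition Ru :: "real^'n^'n \<Rightarrow> (real^'n) set \<Rightarrow> real \<Rightarrow> (real^'n) set" where
  "Ru A U t = {integral {0..t} (\<lambda>s. mexp (s *\<^sub>R A) *v w s) | w.
                 w measurable_on {0..t} \<and> (\<forall>s\<in>{0..t}. w s \<in> U)}"

definition Rt :: "real^'n^'n \<Rightarrow> (real^'n) set \<Rightarrow> (real^'n) set \<Rightarrow> real \<Rightarrow> (real^'n) set" where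
  "Rt A X0 U t = msum (Rh A X0 t) (Ru A U t)"

definition Rint :: "real^'n^'n \<Rightarrow> (real^'n) set \<Rightarrow> (real^'n) set \<Rightarrow> real \<Rightarrow> (real^'n) set" where
  "Rint A X0 U T = (\<Union>t\<in>{0..T}. Rt A X0 U t)"

text \<open>The scheme: S_i, V_i (representations), W_i, Lambda_i (sets).\<close>
definition Srep :: "(real^'n \<Rightarrow> real) \<Rightarrow> (real^'p \<Rightarrow> real) \<Rightarrow> real^'n^'n \<Rightarrow> real \<Rightarrow> nat
                    \<Rightarrow> (real^'n) \<times> (real^'p^'n) \<Rightarrow> nat \<Rightarrow> (real^'n) \<times> (real^'p^'n)" where
  "Srep nn np A T N X0 i =
     ((Hrep nn np A (T / real N) (1 - 1 / (real N)^2)) ^^ i) X0"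

definition Vrep :: "(real^'n \<Rightarrow> real) \<Rightarrow> (real^'q \<Rightarrow> real) \<Rightarrow> real^'n^'n \<Rightarrow> real \<Rightarrow> nat
                    \<Rightarrow> (real^'n) \<times> (real^'q^'n) \<Rightarrow> nat \<Rightarrow> (real^'n) \<times> (real^'q^'n)" where
  "Vrep nn nq A T N U i =
     ((Hrep nn nq A (T / real N) (1 - 1 / (real N)^2)) ^^ i)
       (Irep nn nq A (T / real N) (1 - 1 / real N) U)"

fun Wset :: "(real^'n \<Rightarrow> real) \<Rightarrow> (real^'q \<Rightarrow> real) \<Rightarrow> real^'n^'n \<Rightarrow> real \<Rightarrow> nat
                    \<Rightarrow> (real^'n) \<times> (real^'q^'n) \<Rightarrow> nat \<Rightarrow> (real^'n) set" where
  "Wset nn nq A T N U 0 = {0}"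
| "Wset nn nq A T N U (Suc i) = msum (Wset nn nq A T N U i) (zset nq (Vrep nn nq A T N U i))"

definition Lset :: "(real^'n \<Rightarrow> real) \<Rightarrow> (real^'p \<Rightarrow> real) \<Rightarrow> (real^'q \<Rightarrow> real) \<Rightarrow> real^'n^'n
                    \<Rightarrow> real \<Rightarrow> nat \<Rightarrow> (real^'n) \<times> (real^'p^'n) \<Rightarrow> (real^'n) \<times> (real^'q^'n) \<Rightarrow> nat \<Rightarrow> (real^'n) set" where
  "Lset nn np nq A T N X0 U i = msum (zset np (Srep nn np A T N X0 i)) (Wset nn nq A T N U i)"

end

theory Submission
  imports Defs
begin

(*
  All sets of the scheme are zonotopes c + G B, and one step of H maps (c, G) to (L c, lam L G),
  where L = L(tau, kappa) differs from e^(tau A) by at most theta(tau |A|, kappa), which is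
  O(tau^2) because kappa >= 2, and eps_h < lam <= 1.  After i <= N steps the matrix is within
  O(i tau^2) of e^(i tau A), and the accumulated factor mu on the generators satisfies
  1 - mu <= i (1 - eps_h) <= 1/N; so S_i is O(tau)-close to e^(i tau A) X0.  Since
  T(tau, eta) = tau I + O(tau^2) and 1 - eps_u = 1/N, every V_j is O(tau^2)-close to
  tau e^(j tau A) U, and W_i is O(tau)-close to the Riemann sum of the sets tau e^(j tau A) U,
  j < i.  Adding one term of this sum costs O(tau^2) against R_u: an input is extended by a
  constant on the new interval and, conversely, an input is replaced there by its mean value,
  which lies in U by convexity.  Every point of R(t) is O(tau)-close to a point of
  R(floor(t / tau) tau), which handles the union over i.  All estimates are made in the
  Euclidean norm, which bounds the Hausdorff distance for any norm up to a constant factor.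
*)

section \<open>Norms on finite-dimensional spaces\<close>

context
  fixes f :: "'a::real_vector \<Rightarrow> real"
  assumes f: "is_norm f"
begin

lemma is_norm_nonneg: "0 \<le> f x"
  using f unfolding is_norm_def by blast

lemma is_norm_eq_0_iff: "f x = 0 \<longleftrightarrow> x = 0"
  using f unfolding is_norm_def by blast

lemma is_norm_zero: "f 0 = 0"
  using is_norm_eq_0_iff by blast

lemma is_norm_pos: "x \<noteq> 0 \<Longrightarrow> 0 < f x"
  using is_norm_nonneg[of x] is_norm_eq_0_iff[of x] by linarith

lemma is_norm_scaleR: "f (a *\<^sub>R x) = \<bar>a\<bar> * f x"
  using f unfolding is_norm_def by blast

lemma is_norm_triangle: "f (x + y) \<le> f x + f y"
  using f unfolding is_norm_def by blast

lemma is_norm_minus: "f (- x) = f x"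
  using is_norm_scaleR[of "-1" x] by simp

lemma is_norm_minus_commute: "f (x - y) = f (y - x)"
  using is_norm_minus[of "x - y"] by simp

lemma is_norm_triangle_diff: "\<bar>f x - f y\<bar> \<le> f (x - y)"
  using is_norm_triangle[of y "x - y"] is_norm_triangle[of x "y - x"] is_norm_minus_commute[of x y]
  by simp

lemma is_norm_sum: "f (sum g I) \<le> (\<Sum>i\<in>I. f (g i))"
  by (induct I rule: infinite_finite_induct) (auto simp: is_norm_zero intro: order_trans[OF is_norm_triangle])

lemma convex_on_is_norm: "convex_on UNIV f"
proof (rule convex_onI)
  fix t :: real and x y assume "0 < t" "t < 1"
  then show "f ((1 - t) *\<^sub>R x + t *\<^sub>R y) \<le> (1 - t) * f x + t * f y"
    using is_norm_triangle[of "(1 - t) *\<^sub>R x" "t *\<^sub>R y"] by (simp add: is_norm_scaleR)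
qed simp

lemma convex_nball: "convex (nball f)"
  unfolding convex_def nball_def
  using convex_lower[OF convex_on_is_norm] by (smt (verit) UNIV_I mem_Collect_eq)

lemma zero_in_nball: "0 \<in> nball f"
  unfolding nball_def by (simp add: is_norm_zero)

end

context
  fixes nr :: "real^'k \<Rightarrow> real"
  assumes nr: "is_norm nr"
begin

lemma is_norm_le_norm:
  obtains C where "C \<ge> 0" "\<And>x. nr x \<le> C * norm x"
proof
  define C where "C = (\<Sum>i\<in>UNIV. nr (axis i 1))"
  show "C \<ge> 0" unfolding C_def by (intro sum_nonneg is_norm_nonneg[OF nr])
  fix x :: "real^'k"
  have "x = (\<Sum>i\<in>UNIV. (x $ i) *\<^sub>R axis i 1)"
    by (simp add: vec_eq_iff axis_def if_distrib cong: if_cong)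
  then have "nr x = nr (\<Sum>i\<in>UNIV. (x $ i) *\<^sub>R axis i 1)" by simp
  also have "\<dots> \<le> (\<Sum>i\<in>UNIV. nr ((x $ i) *\<^sub>R axis i 1))" by (rule is_norm_sum[OF nr])
  also have "\<dots> = (\<Sum>i\<in>UNIV. \<bar>x $ i\<bar> * nr (axis i 1))" by (simp add: is_norm_scaleR[OF nr])
  also have "\<dots> \<le> (\<Sum>i\<in>UNIV. norm x * nr (axis i 1))"
    by (intro sum_mono mult_right_mono component_le_norm_cart is_norm_nonneg[OF nr])
  finally show "nr x \<le> C * norm x" by (simp add: C_def sum_distrib_left mult.commute)
qed

lemma continuous_on_is_norm: "continuous_on S nr"
proof -
  obtain C where C: "C \<ge> 0" "\<And>x. nr x \<le> C * norm x" using is_norm_le_norm by blast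
  have "C-lipschitz_on S nr"
  proof (rule lipschitz_onI)
    fix x y
    show "dist (nr x) (nr y) \<le> C * dist x y"
      using is_norm_triangle_diff[OF nr, of x y] C(2)[of "x - y"] by (simp add: dist_real_def dist_norm)
  qed fact
  then show ?thesis by (rule lipschitz_on_continuous_on)
qed

lemma norm_le_is_norm:
  obtains c where "c > 0" "\<And>x. norm x \<le> c * nr x"
proof -
  let ?S = "sphere (0::real^'k) 1"
  have "?S \<noteq> {}" using norm_axis_1[of undefined] by (metis empty_iff mem_sphere_0)
  then obtain x0 where x0: "x0 \<in> ?S" "\<And>y. y \<in> ?S \<Longrightarrow> nr x0 \<le> nr y"
    using continuous_attains_inf[OF compact_sphere _ continuous_on_is_norm] by blast
  have "x0 \<noteq> 0" using x0(1) by auto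
  then have m: "nr x0 > 0" by (rule is_norm_pos[OF nr])
  have "norm x \<le> (1 / nr x0) * nr x" for x
  proof (cases "x = 0")
    case False
    have "nr x0 \<le> nr ((1 / norm x) *\<^sub>R x)" using False by (intro x0(2)) simp
    then show ?thesis using False m by (simp add: is_norm_scaleR[OF nr] field_simps)
  qed (simp add: is_norm_zero[OF nr])
  then show ?thesis using m by (intro that[of "1 / nr x0"]) auto
qed

lemma nball_norm_bound:
  obtains \<rho> where "\<rho> \<ge> 0" "\<And>b. b \<in> nball nr \<Longrightarrow> norm b \<le> \<rho>"
proof -
  obtain c where c: "c > 0" "\<And>x. norm x \<le> c * nr x" using norm_le_is_norm by blast
  have "norm b \<le> c" if "b \<in> nball nr" for b
  proof -
    have "c * nr b \<le> c" using that c(1) unfolding nball_def by (simp add: mult_left_le)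
    then show ?thesis using c(2)[of b] by linarith
  qed
  then show ?thesis using c(1) by (intro that[of c]) auto
qed

lemma compact_nball: "compact (nball nr)"
proof -
  obtain \<rho> where "\<And>b. b \<in> nball nr \<Longrightarrow> norm b \<le> \<rho>" using nball_norm_bound by blast
  then have "bounded (nball nr)" unfolding bounded_iff by blast
  moreover have "closed (nball nr)"
    unfolding nball_def by (rule closed_Collect_le[OF continuous_on_is_norm continuous_on_const])
  ultimately show ?thesis by (simp add: compact_eq_bounded_closed)
qed

end

lemma
  fixes nm :: "real^'m \<Rightarrow> real" and nk :: "real^'k \<Rightarrow> real" and M :: "real^'k^'m"
  assumes nm: "is_norm nm" and nk: "is_norm nk"
  shows opnorm_nonneg: "0 \<le> opnorm nm nk M"
    and opnorm_bound: "nm (M *v x) \<le> opnorm nm nk M * nk x"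
proof -
  obtain C where C: "C \<ge> 0" "\<And>x. nm x \<le> C * norm x" using is_norm_le_norm[OF nm] by blast
  define S where "S = {nm (M *v x) | x. nk x \<le> 1}"
  have "compact ((*v) M ` nball nk)"
    by (rule compact_continuous_image[OF _ compact_nball[OF nk]]) (rule matrix_vector_mult_linear_continuous_on)
  then have "bounded ((*v) M ` nball nk)" by (rule compact_imp_bounded)
  then obtain B where B: "\<And>x. x \<in> nball nk \<Longrightarrow> norm (M *v x) \<le> B"
    unfolding bounded_iff by blast
  have bdd: "bdd_above S"
  proof (rule bdd_aboveI)
    fix s assume "s \<in> S"
    then obtain y where y: "s = nm (M *v y)" "y \<in> nball nk" unfolding S_def nball_def by blast
    show "s \<le> C * B" using order_trans[OF C(2) mult_left_mono[OF B[OF y(2)] C(1)]] y(1) by simp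
  qed
  have "0 \<in> S" using is_norm_zero[OF nk] is_norm_zero[OF nm] unfolding S_def
    by (intro CollectI exI[of _ 0]) simp
  then show "0 \<le> opnorm nm nk M" unfolding opnorm_def S_def[symmetric] using bdd by (rule cSup_upper)
  show "nm (M *v x) \<le> opnorm nm nk M * nk x"
  proof (cases "x = 0")
    case False
    then have nx: "nk x > 0" by (rule is_norm_pos[OF nk])
    then have "nm (M *v ((1 / nk x) *\<^sub>R x)) \<in> S" unfolding S_def by (force simp: is_norm_scaleR[OF nk])
    then have "nm (M *v ((1 / nk x) *\<^sub>R x)) \<le> Sup S" using bdd by (rule cSup_upper)
    then show ?thesis using nx unfolding opnorm_def S_def[symmetric]
      by (simp add: matrix_vector_mult_scaleR is_norm_scaleR[OF nm] pos_divide_le_eq)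
  qed (simp add: is_norm_zero[OF nm] is_norm_zero[OF nk])
qed

lemma opnorm_matpow_bound:
  fixes nn :: "real^'n \<Rightarrow> real"
  assumes nn: "is_norm nn"
  shows "nn (matpow A j *v x) \<le> opnorm nn nn A ^ j * nn x"
proof (induct j arbitrary: x)
  case (Suc j)
  have "nn (matpow A (Suc j) *v x) = nn (A *v (matpow A j *v x))"
    by (simp add: matrix_vector_mul_assoc)
  also have "\<dots> \<le> opnorm nn nn A * nn (matpow A j *v x)" by (rule opnorm_bound[OF nn nn])
  also have "\<dots> \<le> opnorm nn nn A * (opnorm nn nn A ^ j * nn x)"
    by (intro mult_left_mono Suc opnorm_nonneg[OF nn nn])
  finally show ?case by simp
qed simp

section \<open>Closeness of sets and the Hausdorff distance\<close>

definition hclose :: "real \<Rightarrow> ('a::real_normed_vector) set \<Rightarrow> 'a set \<Rightarrow> bool" where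
  "hclose d X Y \<longleftrightarrow> (\<forall>x\<in>X. \<exists>y\<in>Y. norm (x - y) \<le> d) \<and> (\<forall>y\<in>Y. \<exists>x\<in>X. norm (x - y) \<le> d)"

lemma hclose_refl: "hclose 0 X X"
  unfolding hclose_def by auto

lemma hclose_mono: "hclose d X Y \<Longrightarrow> d \<le> d' \<Longrightarrow> hclose d' X Y"
  unfolding hclose_def by (meson order_trans)

lemma hclose_image:
  assumes "\<And>s. s \<in> S \<Longrightarrow> norm (f s - g s) \<le> d"
  shows "hclose d (f ` S) (g ` S)"
  unfolding hclose_def using assms by blast

lemma hclose_trans:
  assumes XY: "hclose d1 X Y" and YZ: "hclose d2 Y Z"
  shows "hclose (d1 + d2) X Z"
proof -
  have tri: "norm (x - z) \<le> d1 + d2" if "norm (x - y) \<le> d1" "norm (y - z) \<le> d2" for x y z :: 'a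
    using norm_triangle_ineq[of "x - y" "y - z"] that by simp
  show ?thesis
    unfolding hclose_def
  proof (intro conjI ballI)
    fix x assume "x \<in> X"
    then obtain y where "y \<in> Y" "norm (x - y) \<le> d1" using XY unfolding hclose_def by blast
    moreover from this obtain z where "z \<in> Z" "norm (y - z) \<le> d2" using YZ unfolding hclose_def by blast
    ultimately show "\<exists>z\<in>Z. norm (x - z) \<le> d1 + d2" using tri by blast
  next
    fix z assume "z \<in> Z"
    then obtain y where "y \<in> Y" "norm (y - z) \<le> d2" using YZ unfolding hclose_def by blast
    moreover from this obtain x where "x \<in> X" "norm (x - y) \<le> d1" using XY unfolding hclose_def by blast
    ultimately show "\<exists>x\<in>X. norm (x - z) \<le> d1 + d2" using tri by blast
  qed
qed

lemma hclose_msum: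
  assumes c1: "hclose d1 X1 Y1" and c2: "hclose d2 X2 Y2"
  shows "hclose (d1 + d2) (msum X1 X2) (msum Y1 Y2)"
proof -
  have tri: "norm ((x1 + x2) - (y1 + y2)) \<le> d1 + d2"
    if "norm (x1 - y1) \<le> d1" "norm (x2 - y2) \<le> d2" for x1 x2 y1 y2 :: 'a
    using norm_triangle_ineq[of "x1 - y1" "x2 - y2"] that by (simp add: algebra_simps)
  show ?thesis
    unfolding hclose_def msum_def
  proof (intro conjI ballI)
    fix z assume "z \<in> {x + y |x y. x \<in> X1 \<and> y \<in> X2}"
    then obtain x1 x2 where z: "z = x1 + x2" "x1 \<in> X1" "x2 \<in> X2" by blast
    obtain y1 where "y1 \<in> Y1" "norm (x1 - y1) \<le> d1" using c1 z(2) unfolding hclose_def by blast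
    moreover obtain y2 where "y2 \<in> Y2" "norm (x2 - y2) \<le> d2" using c2 z(3) unfolding hclose_def by blast
    ultimately show "\<exists>y\<in>{x + y |x y. x \<in> Y1 \<and> y \<in> Y2}. norm (z - y) \<le> d1 + d2"
      using z(1) tri by blast
  next
    fix z assume "z \<in> {x + y |x y. x \<in> Y1 \<and> y \<in> Y2}"
    then obtain y1 y2 where z: "z = y1 + y2" "y1 \<in> Y1" "y2 \<in> Y2" by blast
    obtain x1 where "x1 \<in> X1" "norm (x1 - y1) \<le> d1" using c1 z(2) unfolding hclose_def by blast
    moreover obtain x2 where "x2 \<in> X2" "norm (x2 - y2) \<le> d2" using c2 z(3) unfolding hclose_def by blast
    ultimately show "\<exists>x\<in>{x + y |x y. x \<in> X1 \<and> y \<in> X2}. norm (x - z) \<le> d1 + d2"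
      using z(1) tri by blast
  qed
qed

lemma hausd_le:
  fixes nr :: "real^'n \<Rightarrow> real"
  assumes nr: "is_norm nr" and d: "d \<ge> 0"
    and XY: "\<And>x. x \<in> X \<Longrightarrow> \<exists>y\<in>Y. nr (x - y) \<le> d"
    and YX: "\<And>y. y \<in> Y \<Longrightarrow> \<exists>x\<in>X. nr (x - y) \<le> d"
  shows "hausd nr X Y \<le> d"
proof -
  define S where "S = {\<epsilon>. \<epsilon> > 0 \<and>
      X \<subseteq> {g + \<epsilon> *\<^sub>R b | g b. g \<in> Y \<and> b \<in> nball nr} \<and>
      Y \<subseteq> {w + \<epsilon> *\<^sub>R b | w b. w \<in> X \<and> b \<in> nball nr}}"
  have shift: "x \<in> {g + e *\<^sub>R b | g b. g \<in> Z \<and> b \<in> nball nr}"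
    if e: "e > d" and y: "y \<in> Z" "nr (x - y) \<le> d" for e x y Z
  proof -
    have "nr ((1 / e) *\<^sub>R (x - y)) \<le> 1"
      using e d y(2) by (simp add: is_norm_scaleR[OF nr] divide_le_eq_1)
    moreover have "x = y + e *\<^sub>R ((1 / e) *\<^sub>R (x - y))" using e d by simp
    ultimately show ?thesis using y(1) unfolding nball_def by blast
  qed
  have inS: "e \<in> S" if e: "e > d" for e
  proof -
    have "X \<subseteq> {g + e *\<^sub>R b | g b. g \<in> Y \<and> b \<in> nball nr}"
    proof
      fix x assume "x \<in> X"
      then obtain y where "y \<in> Y" "nr (x - y) \<le> d" using XY by blast
      then show "x \<in> {g + e *\<^sub>R b | g b. g \<in> Y \<and> b \<in> nball nr}" by (rule shift[OF e])
    qed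
    moreover have "Y \<subseteq> {w + e *\<^sub>R b | w b. w \<in> X \<and> b \<in> nball nr}"
    proof
      fix y assume "y \<in> Y"
      then obtain x where "x \<in> X" "nr (x - y) \<le> d" using YX by blast
      then show "y \<in> {w + e *\<^sub>R b | w b. w \<in> X \<and> b \<in> nball nr}"
        using is_norm_minus_commute[OF nr, of x y] by (intro shift[OF e]) simp_all
    qed
    ultimately show ?thesis unfolding S_def using e d by simp
  qed
  have bdd: "bdd_below S" unfolding S_def by (rule bdd_belowI[of _ 0]) auto
  have "Inf S \<le> e" if "e > d" for e using inS[OF that] bdd by (rule cInf_lower)
  then show ?thesis unfolding hausd_def S_def[symmetric] by (rule dense_ge)
qed

lemma hausd_le_hclose:
  fixes nr :: "real^'n \<Rightarrow> real"
  assumes nr: "is_norm nr" and C: "C \<ge> 0" "\<And>x. nr x \<le> C * norm x" and d: "d \<ge> 0"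
    and XY: "hclose d X Y"
  shows "hausd nr X Y \<le> C * d"
proof (rule hausd_le[OF nr])
  have le: "nr (x - y) \<le> C * d" if "norm (x - y) \<le> d" for x y
    using order_trans[OF C(2) mult_left_mono[OF that C(1)]] .
  show "0 \<le> C * d" using C d by simp
  show "\<exists>y\<in>Y. nr (x - y) \<le> C * d" if "x \<in> X" for x
    using XY that le unfolding hclose_def by blast
  show "\<exists>x\<in>X. nr (x - y) \<le> C * d" if "y \<in> Y" for y
    using XY that le unfolding hclose_def by blast
qed

section \<open>Matrix bounds and the matrix exponential\<close>

definition mbound :: "real^'k^'m \<Rightarrow> real \<Rightarrow> bool" where
  "mbound M b \<longleftrightarrow> (\<forall>x. norm (M *v x) \<le> b * norm x)"

lemma mboundD: "mbound M b \<Longrightarrow> norm (M *v x) \<le> b * norm x"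
  unfolding mbound_def by blast

lemma mbound_onorm: "mbound M (onorm ((*v) M))"
  unfolding mbound_def using onorm[OF matrix_vector_mul_bounded_linear] by blast

lemma mbound_mono: "mbound M b \<Longrightarrow> b \<le> b' \<Longrightarrow> mbound M b'"
  unfolding mbound_def by (meson mult_right_mono norm_ge_zero order_trans)

lemma mbound_nonneg: "mbound (M::real^'k^'m) b \<Longrightarrow> b \<ge> 0"
  using order_trans[OF norm_ge_zero mboundD[of M b "axis undefined 1"]] by simp

lemma mbound_mult:
  assumes M: "mbound M a" and P: "mbound P b"
  shows "mbound (M ** P) (a * b)"
  unfolding mbound_def
proof
  fix x
  have "norm ((M ** P) *v x) \<le> a * norm (P *v x)"
    using mboundD[OF M] by (simp add: matrix_vector_mul_assoc[symmetric])
  also have "\<dots> \<le> a * (b * norm x)" using mboundD[OF P] mbound_nonneg[OF M] by (rule mult_left_mono)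
  finally show "norm ((M ** P) *v x) \<le> a * b * norm x" by simp
qed

lemma mbound_add:
  assumes M: "mbound M a" and P: "mbound P b"
  shows "mbound (M + P) (a + b)"
  unfolding mbound_def
proof
  fix x
  have "norm ((M + P) *v x) \<le> norm (M *v x) + norm (P *v x)"
    by (simp add: matrix_vector_mult_add_rdistrib norm_triangle_ineq)
  also have "\<dots> \<le> (a + b) * norm x"
    using add_mono[OF mboundD[OF M] mboundD[OF P]] by (simp add: distrib_right)
  finally show "norm ((M + P) *v x) \<le> (a + b) * norm x" .
qed

lemma mbound_scaleR: "mbound M a \<Longrightarrow> mbound (c *\<^sub>R M) (\<bar>c\<bar> * a)"
  unfolding mbound_def by (simp add: scaleR_matrix_vector_assoc[symmetric] mult.assoc mult_left_mono)

lemma mbound_mat1: "mbound (mat 1 :: real^'n^'n) 1"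
  unfolding mbound_def by simp

lemma mbound_0: "mbound (0 :: real^'k^'m) 0"
  unfolding mbound_def by simp

lemma mbound_sum: "(\<And>j. j \<in> J \<Longrightarrow> mbound (F j) (b j)) \<Longrightarrow> mbound (sum F J) (sum b J)"
  by (induct J rule: infinite_finite_induct) (simp_all add: mbound_0 mbound_add)

lemma mbound_entry:
  assumes "mbound M b" shows "\<bar>M $ i $ j\<bar> \<le> b"
proof -
  have "onorm ((*v) M) \<le> b" using mboundD[OF assms] by (rule onorm_le)
  then show ?thesis using matrix_component_le_onorm[of M i j] by linarith
qed

lemma mbound_norm: "mbound (M::real^'k^'m) b \<Longrightarrow> norm M \<le> real CARD('m) * real CARD('k) * b"
proof -
  assume M: "mbound M b"
  have "norm M \<le> (\<Sum>i\<in>UNIV. norm (M $ i))" unfolding norm_vec_def by (rule L2_set_le_sum) auto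
  also have "\<dots> \<le> (\<Sum>i\<in>(UNIV::'m set). \<Sum>j\<in>(UNIV::'k set). \<bar>M $ i $ j\<bar>)"
    by (intro sum_mono norm_le_l1_cart)
  also have "\<dots> \<le> (\<Sum>i\<in>(UNIV::'m set). \<Sum>j\<in>(UNIV::'k set). b)"
    by (intro sum_mono mbound_entry[OF M])
  finally show ?thesis by simp
qed

lemma mbound_series:
  fixes M :: "real^'k^'m"
  assumes F: "\<And>x. (\<lambda>j. F j *v x) sums (M *v x)" and b: "\<And>j. mbound (F j) (b j)" and B: "b sums B"
  shows "mbound M B"
  unfolding mbound_def
proof
  fix x
  have "norm (M *v x) = norm (\<Sum>j. F j *v x)" using F[of x] by (simp add: sums_iff)
  also have "\<dots> \<le> (\<Sum>j. b j * norm x)"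
    by (rule norm_suminf_le) (auto intro: mboundD[OF b] summable_mult2 sums_summable[OF B])
  also have "\<dots> = B * norm x" using B by (simp add: sums_iff suminf_mult2[symmetric])
  finally show "norm (M *v x) \<le> B * norm x" .
qed

lemma matrix_vector_mult_sum_rdistrib: "sum F J *v x = (\<Sum>j\<in>J. F j *v x)"
  for F :: "_ \<Rightarrow> real^'k^'m"
  by (induct J rule: infinite_finite_induct) (simp_all add: matrix_vector_mult_add_rdistrib)

lemma matpow_add: "matpow M (i + j) = matpow M i ** matpow M j"
  by (induct i) (simp_all add: matrix_mul_assoc)

lemma matpow_scaleR: "matpow (c *\<^sub>R M) j = (c ^ j) *\<^sub>R matpow M j"
  by (induct j) (simp_all add: scalar_matrix_assoc[symmetric] matrix_scalar_ac)

lemma mbound_matpow: "mbound M a \<Longrightarrow> mbound (matpow M j) (a ^ j)"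
  by (induct j) (simp_all add: mbound_mat1 mbound_mult)

lemma matrix_diff_rdistrib: "(A - B) ** C = A ** C - B ** C"
  for A B :: "real^'n^'m" and C :: "real^'k^'n"
  by (simp add: matrix_matrix_mult_def vec_eq_iff sum_subtractf left_diff_distrib)

lemma matrix_diff_ldistrib: "A ** (B - C) = A ** B - A ** C"
  for A :: "real^'n^'m" and B C :: "real^'k^'n"
  by (simp add: matrix_matrix_mult_def vec_eq_iff sum_subtractf right_diff_distrib)

lemma mbound_diff_mult:
  assumes "mbound (M - M') \<beta>" "mbound P b" "mbound M' b'" "mbound (P - P') \<gamma>"
  shows "mbound (M ** P - M' ** P') (\<beta> * b + b' * \<gamma>)"
proof -
  have "M ** P - M' ** P' = (M - M') ** P + M' ** (P - P')"
    by (simp add: matrix_diff_rdistrib matrix_diff_ldistrib)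
  then show ?thesis using assms by (simp add: mbound_add mbound_mult)
qed

lemma exp_sums_real: "(\<lambda>j. r ^ j / fact j) sums exp (r::real)"
  using exp_converges[of r] by (simp add: divide_inverse_commute)

lemma exp_partial_sum_le: "r \<ge> 0 \<Longrightarrow> (\<Sum>j<k. r ^ j / fact j) \<le> exp (r::real)"
  using sum_le_suminf[OF sums_summable[OF exp_sums_real], of "{..<k}" r]
    sums_unique[OF exp_sums_real, of r] by simp

lemma theta_sums: "(\<lambda>j. r ^ (j + k) / fact (j + k)) sums theta r k"
  unfolding theta_def
  by (intro summable_sums summable_ignore_initial_segment sums_summable[OF exp_sums_real])

lemma theta_eq: "theta r k = exp r - (\<Sum>j<k. r ^ j / fact j)"
  using suminf_minus_initial_segment[OF sums_summable[OF exp_sums_real], of r k]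
    sums_unique[OF exp_sums_real] unfolding theta_def by simp

lemma theta_nonneg: "r \<ge> 0 \<Longrightarrow> theta r k \<ge> 0"
  using sums_le[OF _ sums_zero theta_sums] by simp

lemma theta_le:
  assumes r: "r \<ge> 0" and m: "m \<le> k"
  shows "theta r k \<le> r ^ m * exp r"
proof -
  have "r ^ (j + k) / fact (j + k) \<le> r ^ m * (r ^ (j + (k - m)) / fact (j + (k - m)))" for j
  proof -
    have "fact (j + (k - m)) \<le> (fact (j + k) :: real)" by (rule fact_mono) simp
    then have "r ^ (j + (k - m)) / fact (j + k) \<le> r ^ (j + (k - m)) / fact (j + (k - m))"
      using r by (intro divide_left_mono) auto
    then have "r ^ m * (r ^ (j + (k - m)) / fact (j + k))
        \<le> r ^ m * (r ^ (j + (k - m)) / fact (j + (k - m)))"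
      using r by (intro mult_left_mono) auto
    moreover have "r ^ (j + k) = r ^ m * r ^ (j + (k - m))"
      using m by (simp flip: power_add)
    ultimately show ?thesis by simp
  qed
  then have "theta r k \<le> r ^ m * theta r (k - m)"
    using sums_le[OF _ theta_sums sums_mult[OF theta_sums]] by blast
  also have "\<dots> \<le> r ^ m * exp r"
    using r by (intro mult_left_mono) (auto simp: theta_eq intro: sum_nonneg)
  finally show ?thesis .
qed

lemma theta_tendsto_0: "(\<lambda>k. theta r k) \<longlonglongrightarrow> 0"
proof -
  have "(\<lambda>k. exp r - (\<Sum>j<k. r ^ j / fact j)) \<longlonglongrightarrow> exp r - exp r"
    using exp_sums_real[of r] unfolding sums_def by (intro tendsto_diff tendsto_const)
  then show ?thesis by (simp add: theta_eq)
qed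

lemma mbound_exp_term:
  "mbound A a \<Longrightarrow> mbound ((1 / fact j) *\<^sub>R matpow (t *\<^sub>R A) j) ((\<bar>t\<bar> * a) ^ j / fact j)"
  using mbound_scaleR[OF mbound_matpow, of A a "t ^ j / fact j" j]
  by (simp add: matpow_scaleR power_abs power_mult_distrib)

lemma summable_mexp: "summable (\<lambda>j. (1 / fact j) *\<^sub>R matpow (M::real^'n^'n) j)"
proof (rule summable_comparison_test')
  let ?a = "onorm ((*v) M)" and ?c = "real CARD('n) * real CARD('n)"
  show "summable (\<lambda>j. ?c * (?a ^ j / fact j))"
    by (intro summable_mult sums_summable[OF exp_sums_real])
  show "norm ((1 / fact j) *\<^sub>R matpow M j) \<le> ?c * (?a ^ j / fact j)" for j
    using mbound_norm[OF mbound_exp_term[OF mbound_onorm, where t=1]] by simp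
qed

lemma mexp_sums: "(\<lambda>j. (1 / fact j) *\<^sub>R matpow M j) sums mexp M"
  unfolding mexp_def by (rule summable_sums[OF summable_mexp])

lemma bounded_linear_matrix_vector_mult_left: "bounded_linear (\<lambda>P::real^'k^'m. P *v x)"
proof -
  have "linear (\<lambda>P::real^'k^'m. P *v x)"
    by (rule linearI) (simp_all add: matrix_vector_mult_add_rdistrib scaleR_matrix_vector_assoc)
  then show ?thesis by (simp add: linear_conv_bounded_linear)
qed

lemma mexp_mv_sums:
  fixes M :: "real^'n^'n"
  shows "(\<lambda>j. ((1 / fact j) *\<^sub>R matpow M j) *v x) sums (mexp M *v x)"
proof -
  have "bounded_linear (\<lambda>P::real^'n^'n. P *v x)"
    by (rule bounded_linear_matrix_vector_mult_left)
  then show ?thesis by (rule bounded_linear.sums[OF _ mexp_sums])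
qed

lemma mexp_entry_sums:
  fixes M :: "real^'n^'n"
  shows "(\<lambda>j. (1 / fact j) * matpow M j $ i $ l) sums (mexp M $ i $ l)"
proof -
  have "bounded_linear (\<lambda>P::real^'n^'n. P $ i $ l)"
    by (intro bounded_linear_compose[OF bounded_linear_vec_nth] bounded_linear_vec_nth)
  from bounded_linear.sums[OF this mexp_sums] show ?thesis by simp
qed

lemma mbound_mexp: "mbound A a \<Longrightarrow> mbound (mexp (t *\<^sub>R A)) (exp (\<bar>t\<bar> * a))"
  by (rule mbound_series[OF mexp_mv_sums mbound_exp_term exp_sums_real])

lemma mbound_mexp_minus_Lmat:
  assumes "mbound A a"
  shows "mbound (mexp (t *\<^sub>R A) - Lmat A t k) (theta (\<bar>t\<bar> * a) k)"
proof (rule mbound_series[OF _ mbound_exp_term[OF assms] theta_sums])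
  fix x
  show "(\<lambda>j. ((1 / fact (j + k)) *\<^sub>R matpow (t *\<^sub>R A) (j + k)) *v x)
      sums ((mexp (t *\<^sub>R A) - Lmat A t k) *v x)"
    using sums_split_initial_segment[OF mexp_mv_sums[of "t *\<^sub>R A" x], of k]
    by (simp add: Lmat_def matrix_vector_mult_diff_rdistrib matrix_vector_mult_sum_rdistrib)
qed

lemma mbound_Lmat:
  assumes "mbound A a"
  shows "mbound (Lmat A t k) (exp (\<bar>t\<bar> * a))"
proof -
  have "(\<Sum>j<k. (\<bar>t\<bar> * a) ^ j / fact j) \<le> exp (\<bar>t\<bar> * a)"
    using mbound_nonneg[OF assms] by (intro exp_partial_sum_le) simp
  then show ?thesis
    unfolding Lmat_def by (rule mbound_mono[OF mbound_sum[OF mbound_exp_term[OF assms]]])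
qed

lemma sum_power_div_fact_binomial:
  "(\<Sum>p\<le>k. s ^ p / fact p * (t ^ (k - p) / fact (k - p))) = (s + t) ^ k / fact k" for s t :: real
proof -
  have "(s + t) ^ k = (\<Sum>p\<le>k. of_nat (k choose p) * s ^ p * t ^ (k - p))" by (rule binomial_ring)
  also have "\<dots> = fact k * (\<Sum>p\<le>k. s ^ p / fact p * (t ^ (k - p) / fact (k - p)))"
    by (auto simp: sum_distrib_left binomial_fact intro!: sum.cong)
  finally show ?thesis by simp
qed

lemma exp_term_scaleR_add:
  "(1 / fact k) *\<^sub>R matpow ((s + t) *\<^sub>R A) k
   = (\<Sum>p\<le>k. ((1 / fact p) *\<^sub>R matpow (s *\<^sub>R A) p) ** ((1 / fact (k - p)) *\<^sub>R matpow (t *\<^sub>R A) (k - p)))"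
proof -
  have "matpow A p ** matpow A (k - p) = matpow A k" if "p \<le> k" for p
    using that matpow_add[of A p "k - p"] by simp
  then have "(\<Sum>p\<le>k. ((1 / fact p) *\<^sub>R matpow (s *\<^sub>R A) p) ** ((1 / fact (k - p)) *\<^sub>R matpow (t *\<^sub>R A) (k - p)))
      = (\<Sum>p\<le>k. (s ^ p / fact p * (t ^ (k - p) / fact (k - p))) *\<^sub>R matpow A k)"
    by (intro sum.cong) (simp_all add: matpow_scaleR matrix_scalar_ac scalar_matrix_assoc[symmetric] mult_ac)
  also have "\<dots> = ((s + t) ^ k / fact k) *\<^sub>R matpow A k"
    unfolding scaleR_sum_left[symmetric] sum_power_div_fact_binomial ..
  finally show ?thesis by (simp add: matpow_scaleR)
qed

lemma summable_abs_exp_term_entry: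
  "summable (\<lambda>j. \<bar>(1 / fact j) * matpow (M::real^'n^'n) j $ i $ l\<bar>)"
proof (rule summable_comparison_test')
  let ?a = "onorm ((*v) M)"
  show "summable (\<lambda>j. ?a ^ j / fact j)" by (rule sums_summable[OF exp_sums_real])
  show "norm \<bar>(1 / fact j) * matpow M j $ i $ l\<bar> \<le> ?a ^ j / fact j" for j
    using mbound_entry[OF mbound_exp_term[OF mbound_onorm, where t=1], of j M i l]
    by (simp add: onorm_pos_le)
qed

lemma mexp_add: "mexp ((s + t) *\<^sub>R A) = mexp (s *\<^sub>R A) ** mexp (t *\<^sub>R (A::real^'n^'n))"
proof (intro vec_eq_iff[THEN iffD2] allI)
  fix i l
  define \<alpha> where "\<alpha> i m j = (1 / fact j) * matpow (s *\<^sub>R A) j $ i $ m" for i m j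
  define \<beta> where "\<beta> m l j = (1 / fact j) * matpow (t *\<^sub>R A) j $ m $ l" for m l j
  have abs: "summable (\<lambda>j. norm (\<alpha> i m j))" "summable (\<lambda>j. norm (\<beta> m l j))" for m
    unfolding \<alpha>_def \<beta>_def real_norm_def by (rule summable_abs_exp_term_entry)+
  have "(mexp (s *\<^sub>R A) ** mexp (t *\<^sub>R A)) $ i $ l = (\<Sum>m\<in>UNIV. (\<Sum>j. \<alpha> i m j) * (\<Sum>j. \<beta> m l j))"
    unfolding \<alpha>_def \<beta>_def by (simp add: matrix_matrix_mult_def sums_unique[OF mexp_entry_sums])
  also have "\<dots> = (\<Sum>m\<in>UNIV. \<Sum>k. \<Sum>p\<le>k. \<alpha> i m p * \<beta> m l (k - p))"
    using abs by (intro sum.cong refl Cauchy_product)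
  also have "\<dots> = (\<Sum>k. \<Sum>m\<in>UNIV. \<Sum>p\<le>k. \<alpha> i m p * \<beta> m l (k - p))"
    using abs by (intro suminf_sum[symmetric] summable_Cauchy_product)
  also have "\<dots> = (\<Sum>k. ((1 / fact k) *\<^sub>R matpow ((s + t) *\<^sub>R A) k) $ i $ l)"
  proof (rule suminf_cong)
    fix k
    have "((1 / fact k) *\<^sub>R matpow ((s + t) *\<^sub>R A) k) $ i $ l
        = (\<Sum>p\<le>k. \<Sum>m\<in>UNIV. \<alpha> i m p * \<beta> m l (k - p))"
      unfolding exp_term_scaleR_add \<alpha>_def \<beta>_def by (simp add: matrix_matrix_mult_def)
    then show "(\<Sum>m\<in>UNIV. \<Sum>p\<le>k. \<alpha> i m p * \<beta> m l (k - p))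
        = ((1 / fact k) *\<^sub>R matpow ((s + t) *\<^sub>R A) k) $ i $ l"
      by (simp only: sum.swap[of _ UNIV])
  qed
  also have "\<dots> = mexp ((s + t) *\<^sub>R A) $ i $ l"
    using sums_unique[OF mexp_entry_sums, of "(s + t) *\<^sub>R A" i l] by simp
  finally show "mexp ((s + t) *\<^sub>R A) $ i $ l = (mexp (s *\<^sub>R A) ** mexp (t *\<^sub>R A)) $ i $ l" ..
qed

lemma mexp_zero: "mexp (0 *\<^sub>R A) = (mat 1 :: real^'n^'n)"
proof -
  have "(\<lambda>j. (1 / fact j) *\<^sub>R matpow (0 *\<^sub>R A) j) = (\<lambda>j. if j = 0 then mat 1 else 0)"
    by (simp only: matpow_scaleR) (auto simp: fun_eq_iff)
  then show ?thesis using sums_single[of 0 "\<lambda>_. mat 1 :: real^'n^'n"] mexp_sums[of "0 *\<^sub>R A"]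
    by (simp add: sums_unique2)
qed

lemma mexp_mult_of_nat: "mexp ((real j * t) *\<^sub>R A) = matpow (mexp (t *\<^sub>R (A::real^'n^'n))) j"
proof (induct j)
  case (Suc j)
  have "mexp ((real (Suc j) * t) *\<^sub>R A) = mexp ((t + real j * t) *\<^sub>R A)" by (simp add: algebra_simps)
  then show ?case using Suc by (simp add: mexp_add)
qed (simp add: mexp_zero[of A, simplified])

lemma mbound_mexp_minus_mat1:
  assumes "mbound A a"
  shows "mbound (mexp (h *\<^sub>R A) - mat 1) (\<bar>h\<bar> * a * exp (\<bar>h\<bar> * a))"
proof -
  have "mbound (mexp (h *\<^sub>R A) - Lmat A h 1) (theta (\<bar>h\<bar> * a) 1)"
    by (rule mbound_mexp_minus_Lmat[OF assms])
  moreover have "theta (\<bar>h\<bar> * a) 1 \<le> \<bar>h\<bar> * a * exp (\<bar>h\<bar> * a)"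
    using theta_le[of "\<bar>h\<bar> * a" 1 1] mbound_nonneg[OF assms] by simp
  ultimately show ?thesis by (simp add: Lmat_def mbound_mono)
qed

lemma mbound_mexp_diff:
  assumes "mbound A a"
  shows "mbound (mexp (s *\<^sub>R A) - mexp (s0 *\<^sub>R A))
           (exp (\<bar>s0\<bar> * a) * (\<bar>s - s0\<bar> * a * exp (\<bar>s - s0\<bar> * a)))"
proof -
  have "mexp (s *\<^sub>R A) = mexp (s0 *\<^sub>R A) ** mexp ((s - s0) *\<^sub>R A)"
    using mexp_add[of s0 "s - s0" A] by simp
  then have "mexp (s *\<^sub>R A) - mexp (s0 *\<^sub>R A) = mexp (s0 *\<^sub>R A) ** (mexp ((s - s0) *\<^sub>R A) - mat 1)"
    by (simp add: matrix_diff_ldistrib)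
  then show ?thesis by (simp add: mbound_mult mbound_mexp mbound_mexp_minus_mat1 assms)
qed

lemma continuous_on_mexp: "continuous_on S (\<lambda>s. mexp (s *\<^sub>R (A::real^'n^'n)))"
proof (intro continuous_at_imp_continuous_on ballI)
  fix s0 :: real
  define a where "a = onorm ((*v) A)"
  define g where "g s = real CARD('n) * real CARD('n) *
      (exp (\<bar>s0\<bar> * a) * (\<bar>s - s0\<bar> * a * exp (\<bar>s - s0\<bar> * a)))" for s
  have "\<forall>\<^sub>F s in at s0. norm (mexp (s *\<^sub>R A) - mexp (s0 *\<^sub>R A)) \<le> g s"
    unfolding g_def a_def by (intro always_eventually allI mbound_norm mbound_mexp_diff mbound_onorm)
  moreover have "isCont g s0" unfolding g_def by (intro continuous_intros)
  then have "(g \<longlongrightarrow> 0) (at s0)" by (simp add: isCont_def g_def)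
  ultimately have "((\<lambda>s. mexp (s *\<^sub>R A) - mexp (s0 *\<^sub>R A)) \<longlongrightarrow> 0) (at s0)"
    by (rule Lim_null_comparison)
  then show "isCont (\<lambda>s. mexp (s *\<^sub>R A)) s0" by (simp add: isCont_def LIM_zero_iff)
qed

lemma mbound_Tmat_term:
  assumes A: "mbound A a" and t: "t \<ge> 0"
  shows "mbound ((t ^ (j + 1) / fact (j + 1)) *\<^sub>R matpow A j) (t * ((t * a) ^ j / fact j))"
proof (rule mbound_mono[OF mbound_scaleR[OF mbound_matpow[OF A]]])
  have "fact j \<le> (fact (j + 1) :: real)" by (rule fact_mono) simp
  then have "(t * a) ^ j / fact (j + 1) \<le> (t * a) ^ j / fact j"
    using t mbound_nonneg[OF A] by (intro divide_left_mono) auto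
  then have "t * ((t * a) ^ j / fact (j + 1)) \<le> t * ((t * a) ^ j / fact j)"
    using t by (rule mult_left_mono)
  moreover have "\<bar>t ^ (j + 1) / fact (j + 1)\<bar> * a ^ j = t * ((t * a) ^ j / fact (j + 1))"
    using t by (simp add: power_mult_distrib del: fact_Suc)
  ultimately show "\<bar>t ^ (j + 1) / fact (j + 1)\<bar> * a ^ j \<le> t * ((t * a) ^ j / fact j)" by simp
qed

lemma mbound_Tmat:
  assumes A: "mbound A a" and t: "t \<ge> 0"
  shows "mbound (Tmat A t k) (t * exp (t * a))"
proof -
  have "(\<Sum>j<k. t * ((t * a) ^ j / fact j)) = t * (\<Sum>j<k. (t * a) ^ j / fact j)"
    by (rule sum_distrib_left[symmetric])
  also have "\<dots> \<le> t * exp (t * a)"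
    using t mbound_nonneg[OF A] by (intro mult_left_mono exp_partial_sum_le) auto
  finally have "(\<Sum>j<k. t * ((t * a) ^ j / fact j)) \<le> t * exp (t * a)" .
  then show ?thesis
    unfolding Tmat_def by (rule mbound_mono[OF mbound_sum[OF mbound_Tmat_term[OF A t]]])
qed

lemma Tmat_Suc:
  "Tmat A t (Suc m) = t *\<^sub>R mat 1 + (\<Sum>j<m. (t ^ (Suc j + 1) / fact (Suc j + 1)) *\<^sub>R matpow A (Suc j))"
  unfolding Tmat_def by (subst sum.lessThan_Suc_shift) simp

lemma mbound_Tmat_minus:
  assumes A: "mbound A a" and t: "t \<ge> 0" and k: "k \<ge> 1"
  shows "mbound (Tmat A t k - t *\<^sub>R mat 1) (t ^ 2 * a * exp (t * a))"
proof -
  obtain m where m: "k = Suc m" using k by (cases k) auto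
  have a: "a \<ge> 0" by (rule mbound_nonneg[OF A])
  have step: "t * ((t * a) ^ Suc j / fact (Suc j)) \<le> t ^ 2 * a * ((t * a) ^ j / fact j)" for j
  proof -
    have "fact j \<le> (fact (Suc j) :: real)" by (rule fact_mono) simp
    then have "(t * a) ^ j / fact (Suc j) \<le> (t * a) ^ j / fact j"
      using t a by (intro divide_left_mono) auto
    then have le: "t ^ 2 * a * ((t * a) ^ j / fact (Suc j)) \<le> t ^ 2 * a * ((t * a) ^ j / fact j)"
      using t a by (intro mult_left_mono) auto
    have eq: "t * ((t * a) ^ Suc j / fact (Suc j)) = t ^ 2 * a * ((t * a) ^ j / fact (Suc j))"
      unfolding power_Suc power2_eq_square by (simp add: mult_ac)
    show ?thesis unfolding eq by (rule le)
  qed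
  have "(\<Sum>j<m. t * ((t * a) ^ Suc j / fact (Suc j))) \<le> (\<Sum>j<m. t ^ 2 * a * ((t * a) ^ j / fact j))"
    by (intro sum_mono step)
  also have "\<dots> = t ^ 2 * a * (\<Sum>j<m. (t * a) ^ j / fact j)"
    by (rule sum_distrib_left[symmetric])
  also have "\<dots> \<le> t ^ 2 * a * exp (t * a)"
    using t a by (intro mult_left_mono exp_partial_sum_le) auto
  finally have "(\<Sum>j<m. t * ((t * a) ^ Suc j / fact (Suc j))) \<le> t ^ 2 * a * exp (t * a)" .
  moreover have "mbound (\<Sum>j<m. (t ^ (Suc j + 1) / fact (Suc j + 1)) *\<^sub>R matpow A (Suc j))
      (\<Sum>j<m. t * ((t * a) ^ Suc j / fact (Suc j)))"
    by (intro mbound_sum mbound_Tmat_term A t)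
  ultimately show ?thesis unfolding m Tmat_Suc by (simp add: mbound_mono)
qed

lemma power_two_le_fact: "(2::real) ^ (j + 1) \<le> fact (j + 2)"
proof -
  have "(2::nat) * 2 ^ j \<le> fact (j + 2)" by (induct j) simp_all
  then show ?thesis by (metis of_nat_fact of_nat_le_iff of_nat_numeral of_nat_power power_Suc Suc_eq_plus1)
qed

lemma is_norm_Tmat_term_le:
  fixes nn :: "real^'n \<Rightarrow> real" and A :: "real^'n^'n"
  assumes nn: "is_norm nn" and t: "t \<ge> 0" and tA: "t * opnorm nn nn A \<le> 1"
  shows "nn ((t ^ (Suc j + 1) / fact (Suc j + 1)) *\<^sub>R (matpow A (Suc j) *v x)) \<le> t * ((1/2) ^ (j + 1) * nn x)"
proof -
  define \<alpha> where "\<alpha> = opnorm nn nn A"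
  have \<alpha>: "\<alpha> \<ge> 0" using opnorm_nonneg[OF nn nn] unfolding \<alpha>_def by simp
  then have pow: "(t * \<alpha>) ^ Suc j \<le> 1" using tA t unfolding \<alpha>_def by (intro power_le_one) auto
  have "nn ((t ^ (Suc j + 1) / fact (Suc j + 1)) *\<^sub>R (matpow A (Suc j) *v x))
      = t ^ (Suc j + 1) / fact (Suc j + 1) * nn (matpow A (Suc j) *v x)"
    using t by (simp add: is_norm_scaleR[OF nn])
  also have "\<dots> \<le> t ^ (Suc j + 1) / fact (Suc j + 1) * (\<alpha> ^ Suc j * nn x)"
    using t unfolding \<alpha>_def by (intro mult_left_mono opnorm_matpow_bound[OF nn]) auto
  also have "\<dots> = t * ((t * \<alpha>) ^ Suc j / fact (j + 2) * nn x)"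
    by (simp add: algebra_simps)
  also have "\<dots> \<le> t * (1 / fact (j + 2) * nn x)"
    using t pow is_norm_nonneg[OF nn] by (intro mult_left_mono mult_right_mono divide_right_mono) auto
  also have "\<dots> \<le> t * ((1/2) ^ (j + 1) * nn x)"
    using t is_norm_nonneg[OF nn] power_two_le_fact[of j]
    by (intro mult_left_mono mult_right_mono) (auto simp: divide_simps)
  finally show ?thesis .
qed

lemma is_norm_Tmat_minus_le:
  fixes nn :: "real^'n \<Rightarrow> real" and A :: "real^'n^'n"
  assumes nn: "is_norm nn" and t: "t \<ge> 0" and tA: "t * opnorm nn nn A \<le> 1"
  shows "nn (Tmat A t (Suc m) *v x - t *\<^sub>R x) \<le> t * nn x * (1 - (1/2) ^ m)"
proof -
  have "Tmat A t (Suc m) *v x - t *\<^sub>R x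
      = (\<Sum>j<m. (t ^ (Suc j + 1) / fact (Suc j + 1)) *\<^sub>R (matpow A (Suc j) *v x))"
    unfolding Tmat_Suc
    by (simp add: matrix_vector_mult_add_rdistrib matrix_vector_mult_sum_rdistrib
        scaleR_matrix_vector_assoc[symmetric])
  then have "nn (Tmat A t (Suc m) *v x - t *\<^sub>R x)
      \<le> (\<Sum>j<m. nn ((t ^ (Suc j + 1) / fact (Suc j + 1)) *\<^sub>R (matpow A (Suc j) *v x)))"
    using is_norm_sum[OF nn] by simp
  also have "\<dots> \<le> (\<Sum>j<m. t * ((1/2) ^ (j + 1) * nn x))"
    by (intro sum_mono is_norm_Tmat_term_le[OF nn t tA])
  also have "\<dots> = t * nn x * (\<Sum>j<m. (1/2) ^ (j + 1))"
    unfolding sum_distrib_left by (simp add: mult_ac)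
  also have "(\<Sum>j<m. (1/2::real) ^ (j + 1)) = 1 - (1/2) ^ m"
    by (induct m) (simp_all add: algebra_simps)
  finally show ?thesis .
qed

lemma Tmat_invertible:
  fixes nn :: "real^'n \<Rightarrow> real" and A :: "real^'n^'n"
  assumes nn: "is_norm nn" and t: "t > 0" and tA: "t * opnorm nn nn A \<le> 1" and k: "k \<ge> 1"
  shows "invertible (Tmat A t k)"
proof -
  obtain m where m: "k = Suc m" using k by (cases k) auto
  have "x = 0" if "Tmat A t k *v x = 0" for x
  proof (rule ccontr)
    assume "x \<noteq> 0"
    then have "0 < t * nn x" using t is_norm_pos[OF nn] by simp
    moreover have "t * nn x * 1 \<le> t * nn x * (1 - (1/2) ^ m)"
      using is_norm_Tmat_minus_le[OF nn _ tA, of m x] that t unfolding m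
      by (simp add: is_norm_minus[OF nn] is_norm_scaleR[OF nn])
    ultimately have "1 \<le> 1 - (1/2::real) ^ m" by (simp only: mult_le_cancel_left_pos)
    then show False using zero_less_power[of "1/2::real" m] by linarith
  qed
  then show ?thesis unfolding invertible_left_inverse matrix_left_invertible_ker by blast
qed

section \<open>The approximation scheme\<close>

lemma lam_le_1:
  fixes nn :: "real^'n \<Rightarrow> real" and np :: "real^'p \<Rightarrow> real"
  assumes nn: "is_norm nn" and np: "is_norm np" and t: "t \<ge> 0"
  shows "lam nn np A t r k \<le> 1"
proof -
  define e where "e = exp (t * opnorm nn nn A) * theta (t * opnorm nn nn A) k"
  have "e \<ge> 0" unfolding e_def using t opnorm_nonneg[OF nn nn] by (simp add: theta_nonneg)
  then have "0 \<le> e * opnorm np nn (pinv (snd r)) * nn (fst r)"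
      "0 \<le> e * opnorm np nn (pinv (snd r)) * opnorm nn np (snd r)"
    using opnorm_nonneg[OF np nn] opnorm_nonneg[OF nn np] is_norm_nonneg[OF nn] by simp_all
  moreover have "(1 - p) / (1 + q) \<le> 1" if "0 \<le> p" "0 \<le> q" for p q :: real
    using that by (simp add: divide_le_eq_1)
  ultimately show ?thesis unfolding lam_def Let_def e_def[symmetric] by blast
qed

lemma lam_tendsto_1: "(\<lambda>k. lam nn np A t r k) \<longlonglongrightarrow> 1"
proof -
  let ?a = "t * opnorm nn nn A"
  have "(\<lambda>k. exp ?a * theta ?a k) \<longlonglongrightarrow> exp ?a * 0"
    by (intro tendsto_mult tendsto_const theta_tendsto_0)
  then have "(\<lambda>k. lam nn np A t r k) \<longlonglongrightarrow>
      (1 - exp ?a * 0 * opnorm np nn (pinv (snd r)) * nn (fst r)) /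
      (1 + exp ?a * 0 * opnorm np nn (pinv (snd r)) * opnorm nn np (snd r))"
    unfolding lam_def Let_def by (intro tendsto_intros) simp_all
  then show ?thesis by simp
qed

lemma kappa_spec:
  assumes "\<epsilon> < 1"
  shows "2 \<le> kappa nn np A t r \<epsilon>" "\<epsilon> < lam nn np A t r (kappa nn np A t r \<epsilon>)"
proof -
  have "eventually (\<lambda>k. max (kmin A t) 2 \<le> k \<and> \<epsilon> < lam nn np A t r k) sequentially"
    using eventually_ge_at_top order_tendstoD(1)[OF lam_tendsto_1 assms] by (rule eventually_conj)
  then obtain k where "max (kmin A t) 2 \<le> k \<and> \<epsilon> < lam nn np A t r k"
    by (auto simp: eventually_sequentially)
  then have "max (kmin A t) 2 \<le> kappa nn np A t r \<epsilon> \<and> \<epsilon> < lam nn np A t r (kappa nn np A t r \<epsilon>)"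
    unfolding kappa_def by (rule LeastI)
  then show "2 \<le> kappa nn np A t r \<epsilon>" "\<epsilon> < lam nn np A t r (kappa nn np A t r \<epsilon>)" by simp_all
qed

lemma eta_spec:
  fixes nn :: "real^'n \<Rightarrow> real" and A :: "real^'n^'n"
  assumes nn: "is_norm nn" and t: "t > 0" and tA: "t * opnorm nn nn A \<le> 1" and \<epsilon>: "\<epsilon> < 1"
  shows "1 \<le> eta nn np A t r \<epsilon>" "\<epsilon> < lam nn np A t r (eta nn np A t r \<epsilon>)"
proof -
  have "eventually (\<lambda>k. 1 \<le> k \<and> \<epsilon> < lam nn np A t r k) sequentially"
    using eventually_ge_at_top order_tendstoD(1)[OF lam_tendsto_1 \<epsilon>] by (rule eventually_conj)
  then obtain k where "1 \<le> k" "\<epsilon> < lam nn np A t r k" by (auto simp: eventually_sequentially)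
  then have "\<epsilon> < lam nn np A t r k \<and> invertible (Tmat A t k)"
    using Tmat_invertible[OF nn t tA] by blast
  then have eta: "\<epsilon> < lam nn np A t r (eta nn np A t r \<epsilon>) \<and> invertible (Tmat A t (eta nn np A t r \<epsilon>))"
    unfolding eta_def by (rule LeastI)
  moreover have "det (0::real^'n^'n) = 0" by (rule det_zero_row(1)[of undefined]) (simp add: row_def vec_eq_iff)
  ultimately have "Tmat A t (eta nn np A t r \<epsilon>) \<noteq> 0" by (auto simp: invertible_det_nz)
  then show "1 \<le> eta nn np A t r \<epsilon>" by (cases "eta nn np A t r \<epsilon>") (auto simp: Tmat_def)
  show "\<epsilon> < lam nn np A t r (eta nn np A t r \<epsilon>)" using eta ..
qed

lemma zset_image: "zset np r = (\<lambda>b. fst r + snd r *v b) ` nball np"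
  unfolding zset_def by auto

lemma nball_image_bound:
  fixes np :: "real^'p \<Rightarrow> real" and G :: "real^'p^'n"
  assumes np: "is_norm np"
  obtains R where "0 \<le> R" "\<forall>b\<in>nball np. norm (G *v b) \<le> R"
proof -
  obtain \<rho> where \<rho>: "\<rho> \<ge> 0" "\<And>b. b \<in> nball np \<Longrightarrow> norm b \<le> \<rho>"
    using nball_norm_bound[OF np] by blast
  have "norm (G *v b) \<le> onorm ((*v) G) * \<rho>" if "b \<in> nball np" for b
    using order_trans[OF mboundD[OF mbound_onorm] mult_left_mono[OF \<rho>(2)[OF that] onorm_pos_le]] by simp
  then show ?thesis using \<rho>(1) by (intro that[of "onorm ((*v) G) * \<rho>"]) (auto simp: onorm_pos_le)
qed

lemma nball_image_bound_nonneg: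
  "is_norm np \<Longrightarrow> \<forall>b\<in>nball np. norm (G *v b) \<le> R \<Longrightarrow> 0 \<le> R"
  using zero_in_nball by force

lemma norm_zset_le:
  "\<forall>b\<in>nball np. norm (snd r *v b) \<le> R \<Longrightarrow> x \<in> zset np r \<Longrightarrow> norm x \<le> norm (fst r) + R"
  unfolding zset_def by (auto intro: order_trans[OF norm_triangle_ineq])

lemma compact_zset: "is_norm np \<Longrightarrow> compact (zset np r)"
  unfolding zset_image by (intro compact_continuous_image compact_nball continuous_intros)

lemma convex_zset: "is_norm np \<Longrightarrow> convex (zset np r)"
proof -
  assume np: "is_norm np"
  have "zset np r = (+) (fst r) ` ((*v) (snd r) ` nball np)" unfolding zset_image image_image ..
  then show ?thesis by (simp add: convex_translation convex_linear_image convex_nball[OF np])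
qed

lemma zset_nonempty: "is_norm np \<Longrightarrow> zset np r \<noteq> {}"
  unfolding zset_image using zero_in_nball by blast

lemma zset_hclose:
  fixes M P :: "real^'n^'n" and G :: "real^'p^'n"
  assumes MP: "mbound (M - P) \<beta>" and M: "mbound M \<beta>'"
    and R: "\<forall>b\<in>nball np. norm (G *v b) \<le> R" and \<mu>: "0 \<le> \<mu>" "\<mu> \<le> 1"
  shows "hclose (\<beta> * (norm c + R) + (1 - \<mu>) * (\<beta>' * R))
     (zset np (M *v c, \<mu> *\<^sub>R (M ** G))) ((*v) P ` zset np (c, G))"
proof -
  have "norm ((M *v c + (\<mu> *\<^sub>R (M ** G)) *v b) - P *v (c + G *v b))
      \<le> \<beta> * (norm c + R) + (1 - \<mu>) * (\<beta>' * R)" if b: "b \<in> nball np" for b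
  proof -
    have Gb: "norm (G *v b) \<le> R" using R b by blast
    have "(M *v c + (\<mu> *\<^sub>R (M ** G)) *v b) - P *v (c + G *v b)
        = (M - P) *v (c + G *v b) + (\<mu> - 1) *\<^sub>R (M *v (G *v b))"
      by (simp add: algebra_simps matrix_vector_mul_assoc[symmetric] scaleR_matrix_vector_assoc[symmetric])
    moreover have "norm ((M - P) *v (c + G *v b)) \<le> \<beta> * (norm c + R)"
      using mboundD[OF MP] mbound_nonneg[OF MP] norm_triangle_ineq[of c "G *v b"] Gb
      by (meson add_left_mono mult_left_mono order_trans)
    moreover have "norm ((\<mu> - 1) *\<^sub>R (M *v (G *v b))) \<le> (1 - \<mu>) * (\<beta>' * R)"
      using mboundD[OF M, of "G *v b"] mbound_nonneg[OF M] Gb \<mu>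
      by (simp add: mult_left_mono order_trans)
    ultimately show ?thesis by (metis add_mono norm_triangle_le)
  qed
  then show ?thesis unfolding zset_image image_image by (intro hclose_image) simp
qed

lemma Hrep_step:
  fixes nn :: "real^'n \<Rightarrow> real" and np :: "real^'p \<Rightarrow> real" and A :: "real^'n^'n"
  assumes nn: "is_norm nn" and np: "is_norm np" and t: "t \<ge> 0" and \<epsilon>: "\<epsilon> < 1"
    and A: "mbound A a"
  obtains L l where "Hrep nn np A t \<epsilon> r = (L *v fst r, l *\<^sub>R (L ** snd r))"
    "mbound L (exp (t * a))" "mbound (L - mexp (t *\<^sub>R A)) ((t * a) ^ 2 * exp (t * a))"
    "\<epsilon> < l" "l \<le> 1"
proof
  define k where "k = kappa nn np A t r \<epsilon>"
  show "Hrep nn np A t \<epsilon> r = (Lmat A t k *v fst r, lam nn np A t r k *\<^sub>R (Lmat A t k ** snd r))"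
    unfolding Hrep_def k_def Let_def ..
  show "mbound (Lmat A t k) (exp (t * a))" using mbound_Lmat[OF A, of t k] t by simp
  have "mbound (Lmat A t k - mexp (t *\<^sub>R A)) (theta (t * a) k)"
    using mbound_scaleR[OF mbound_mexp_minus_Lmat[OF A, of t k], of "-1"] t by simp
  moreover have "2 \<le> k" unfolding k_def by (rule kappa_spec(1)[OF \<epsilon>])
  then have "theta (t * a) k \<le> (t * a) ^ 2 * exp (t * a)"
    using t mbound_nonneg[OF A] by (intro theta_le) auto
  ultimately show "mbound (Lmat A t k - mexp (t *\<^sub>R A)) ((t * a) ^ 2 * exp (t * a))"
    by (rule mbound_mono)
  show "\<epsilon> < lam nn np A t r k" unfolding k_def by (rule kappa_spec(2)[OF \<epsilon>])
  show "lam nn np A t r k \<le> 1" by (rule lam_le_1[OF nn np t])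
qed

lemma one_minus_mult_le:
  fixes l \<mu> \<epsilon> :: real
  assumes "\<epsilon> \<le> l" "l \<le> 1" "\<mu> \<le> 1"
  shows "1 - l * \<mu> \<le> (1 - \<epsilon>) + (1 - \<mu>)"
proof -
  have "l * (1 - \<mu>) \<le> 1 * (1 - \<mu>)" using assms by (intro mult_right_mono) auto
  then show ?thesis using assms by (simp add: algebra_simps)
qed

lemma Hrep_iterate:
  fixes nn :: "real^'n \<Rightarrow> real" and np :: "real^'p \<Rightarrow> real" and A :: "real^'n^'n"
  assumes nn: "is_norm nn" and np: "is_norm np" and t: "t \<ge> 0" and \<epsilon>: "0 \<le> \<epsilon>" "\<epsilon> < 1"
    and A: "mbound A a"
  obtains M \<mu> where "(Hrep nn np A t \<epsilon> ^^ i) r = (M *v fst r, \<mu> *\<^sub>R (M ** snd r))"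
    "mbound M (exp (real i * (t * a)))"
    "mbound (M - matpow (mexp (t *\<^sub>R A)) i) (real i * (t * a) ^ 2 * exp (real i * (t * a)))"
    "0 \<le> \<mu>" "\<mu> \<le> 1" "1 - \<mu> \<le> real i * (1 - \<epsilon>)"
proof (induction i arbitrary: thesis)
  case 0
  show ?case by (rule "0.prems"[of "mat 1" 1]) (simp_all add: mbound_mat1 mbound_0)
next
  case (Suc i)
  obtain M \<mu> where IH: "(Hrep nn np A t \<epsilon> ^^ i) r = (M *v fst r, \<mu> *\<^sub>R (M ** snd r))"
    "mbound M (exp (real i * (t * a)))"
    "mbound (M - matpow (mexp (t *\<^sub>R A)) i) (real i * (t * a) ^ 2 * exp (real i * (t * a)))"
    "0 \<le> \<mu>" "\<mu> \<le> 1" "1 - \<mu> \<le> real i * (1 - \<epsilon>)"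
    by (rule Suc.IH)
  obtain L l where L: "Hrep nn np A t \<epsilon> ((Hrep nn np A t \<epsilon> ^^ i) r)
      = (L *v fst ((Hrep nn np A t \<epsilon> ^^ i) r), l *\<^sub>R (L ** snd ((Hrep nn np A t \<epsilon> ^^ i) r)))"
    "mbound L (exp (t * a))" "mbound (L - mexp (t *\<^sub>R A)) ((t * a) ^ 2 * exp (t * a))"
    "\<epsilon> < l" "l \<le> 1"
    by (rule Hrep_step[OF nn np t \<epsilon>(2) A])
  have exp_Suc: "exp (real (Suc i) * (t * a)) = exp (t * a) * exp (real i * (t * a))"
    by (simp add: exp_add[symmetric] algebra_simps)
  show ?case
  proof (rule Suc.prems)
    show "(Hrep nn np A t \<epsilon> ^^ Suc i) r = ((L ** M) *v fst r, (l * \<mu>) *\<^sub>R ((L ** M) ** snd r))"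
      using L(1) unfolding funpow.simps comp_def IH(1)
      by (simp add: matrix_vector_mul_assoc matrix_scalar_ac matrix_mul_assoc scalar_matrix_assoc[symmetric])
    show "mbound (L ** M) (exp (real (Suc i) * (t * a)))"
      unfolding exp_Suc by (rule mbound_mult[OF L(2) IH(2)])
    have "mbound (L ** M - mexp (t *\<^sub>R A) ** matpow (mexp (t *\<^sub>R A)) i)
        ((t * a) ^ 2 * exp (t * a) * exp (real i * (t * a))
         + exp (t * a) * (real i * (t * a) ^ 2 * exp (real i * (t * a))))"
      using mbound_diff_mult[OF L(3) IH(2) _ IH(3)] mbound_mexp[OF A, of t] t by simp
    then show "mbound (L ** M - matpow (mexp (t *\<^sub>R A)) (Suc i))
        (real (Suc i) * (t * a) ^ 2 * exp (real (Suc i) * (t * a)))"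
      unfolding exp_Suc by (simp add: algebra_simps)
    show "0 \<le> l * \<mu>" using L(4) \<epsilon> IH(4) by simp
    show "l * \<mu> \<le> 1" using L(4,5) IH(4,5) \<epsilon> by (simp add: mult_le_one)
    show "1 - l * \<mu> \<le> real (Suc i) * (1 - \<epsilon>)"
      using one_minus_mult_le[of \<epsilon> l \<mu>] L(4,5) IH(5,6) by (simp add: algebra_simps)
  qed
qed

lemma zset_Hrep_iterate_hclose:
  fixes nn :: "real^'n \<Rightarrow> real" and np :: "real^'p \<Rightarrow> real" and A :: "real^'n^'n"
  assumes nn: "is_norm nn" and np: "is_norm np" and t: "t \<ge> 0" and \<epsilon>: "0 \<le> \<epsilon>" "\<epsilon> < 1"
    and A: "mbound A a" and R: "\<forall>b\<in>nball np. norm (snd X *v b) \<le> R"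
  shows "hclose (real i * (t * a) ^ 2 * exp (real i * (t * a)) * (norm (fst X) + R)
       + real i * (1 - \<epsilon>) * (exp (real i * (t * a)) * R))
     (zset np ((Hrep nn np A t \<epsilon> ^^ i) X)) (Rh A (zset np X) (real i * t))"
proof -
  obtain M \<mu> where H: "(Hrep nn np A t \<epsilon> ^^ i) X = (M *v fst X, \<mu> *\<^sub>R (M ** snd X))"
    "mbound M (exp (real i * (t * a)))"
    "mbound (M - matpow (mexp (t *\<^sub>R A)) i) (real i * (t * a) ^ 2 * exp (real i * (t * a)))"
    "0 \<le> \<mu>" "\<mu> \<le> 1" "1 - \<mu> \<le> real i * (1 - \<epsilon>)"
    using Hrep_iterate[OF nn np t \<epsilon> A] by metis
  have "hclose (real i * (t * a) ^ 2 * exp (real i * (t * a)) * (norm (fst X) + R)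
       + (1 - \<mu>) * (exp (real i * (t * a)) * R))
     (zset np ((Hrep nn np A t \<epsilon> ^^ i) X)) (Rh A (zset np X) (real i * t))"
    unfolding H(1) Rh_def mexp_mult_of_nat using zset_hclose[OF H(3) H(2) R H(4,5), where c = "fst X"] by simp
  moreover have "(1 - \<mu>) * (exp (real i * (t * a)) * R) \<le> real i * (1 - \<epsilon>) * (exp (real i * (t * a)) * R)"
    using H(6) nball_image_bound_nonneg[OF np R] by (intro mult_right_mono) auto
  ultimately show ?thesis by (rule hclose_mono[OF _ add_left_mono])
qed

lemma Irep_step:
  fixes nn :: "real^'n \<Rightarrow> real" and nq :: "real^'q \<Rightarrow> real" and A :: "real^'n^'n"
  assumes nn: "is_norm nn" and nq: "is_norm nq" and t: "t > 0" and tA: "t * opnorm nn nn A \<le> 1"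
    and \<phi>: "\<phi> < 1" and A: "mbound A a"
  obtains Tm l where "Irep nn nq A t \<phi> U = (Tm *v fst U, l *\<^sub>R (Tm ** snd U))"
    "mbound Tm (t * exp (t * a))" "mbound (Tm - t *\<^sub>R mat 1) (t ^ 2 * a * exp (t * a))"
    "\<phi> < l" "l \<le> 1"
proof
  define k where "k = eta nn nq A t U \<phi>"
  show "Irep nn nq A t \<phi> U = (Tmat A t k *v fst U, lam nn nq A t U k *\<^sub>R (Tmat A t k ** snd U))"
    unfolding Irep_def k_def Let_def ..
  show "mbound (Tmat A t k) (t * exp (t * a))" using mbound_Tmat[OF A] t by simp
  show "mbound (Tmat A t k - t *\<^sub>R mat 1) (t ^ 2 * a * exp (t * a))"
    using mbound_Tmat_minus[OF A _ eta_spec(1)[OF nn t tA \<phi>, where np = nq and r = U]] t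
    unfolding k_def by simp
  show "\<phi> < lam nn nq A t U k" unfolding k_def by (rule eta_spec(2)[OF nn t tA \<phi>])
  show "lam nn nq A t U k \<le> 1" using t by (intro lam_le_1[OF nn nq]) simp
qed

lemma Hrep_iterate_Irep:
  fixes nn :: "real^'n \<Rightarrow> real" and nq :: "real^'q \<Rightarrow> real" and A :: "real^'n^'n"
  assumes nn: "is_norm nn" and nq: "is_norm nq" and t: "t > 0" and tA: "t * opnorm nn nn A \<le> 1"
    and \<epsilon>: "0 \<le> \<epsilon>" "\<epsilon> < 1" and \<phi>: "0 \<le> \<phi>" "\<phi> < 1" and A: "mbound A a"
  obtains M \<mu> where "(Hrep nn nq A t \<epsilon> ^^ j) (Irep nn nq A t \<phi> U) = (M *v fst U, \<mu> *\<^sub>R (M ** snd U))"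
    "mbound M (exp (real j * (t * a)) * (t * exp (t * a)))"
    "mbound (M - t *\<^sub>R matpow (mexp (t *\<^sub>R A)) j)
       (real j * (t * a) ^ 2 * exp (real j * (t * a)) * (t * exp (t * a))
        + exp (real j * (t * a)) * (t ^ 2 * a * exp (t * a)))"
    "0 \<le> \<mu>" "\<mu> \<le> 1" "1 - \<mu> \<le> (1 - \<phi>) + real j * (1 - \<epsilon>)"
proof -
  obtain Tm l where I: "Irep nn nq A t \<phi> U = (Tm *v fst U, l *\<^sub>R (Tm ** snd U))"
    "mbound Tm (t * exp (t * a))" "mbound (Tm - t *\<^sub>R mat 1) (t ^ 2 * a * exp (t * a))"
    "\<phi> < l" "l \<le> 1"
    by (rule Irep_step[OF nn nq t tA \<phi>(2) A])
  obtain M \<mu> where H: "(Hrep nn nq A t \<epsilon> ^^ j) (Irep nn nq A t \<phi> U)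
      = (M *v fst (Irep nn nq A t \<phi> U), \<mu> *\<^sub>R (M ** snd (Irep nn nq A t \<phi> U)))"
    "mbound M (exp (real j * (t * a)))"
    "mbound (M - matpow (mexp (t *\<^sub>R A)) j) (real j * (t * a) ^ 2 * exp (real j * (t * a)))"
    "0 \<le> \<mu>" "\<mu> \<le> 1" "1 - \<mu> \<le> real j * (1 - \<epsilon>)"
    using Hrep_iterate[OF nn nq _ \<epsilon> A] t by (metis less_imp_le)
  have E: "mbound (matpow (mexp (t *\<^sub>R A)) j) (exp (real j * (t * a)))"
    unfolding mexp_mult_of_nat[symmetric] using mbound_mexp[OF A, of "real j * t"] t
    by (simp add: abs_mult mult.assoc)
  show ?thesis
  proof (rule that)
    show "(Hrep nn nq A t \<epsilon> ^^ j) (Irep nn nq A t \<phi> U) = ((M ** Tm) *v fst U, (l * \<mu>) *\<^sub>R ((M ** Tm) ** snd U))"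
      unfolding H(1) unfolding I(1)
      by (simp add: matrix_vector_mul_assoc matrix_scalar_ac matrix_mul_assoc scalar_matrix_assoc[symmetric])
    show "mbound (M ** Tm) (exp (real j * (t * a)) * (t * exp (t * a)))" by (rule mbound_mult[OF H(2) I(2)])
    show "mbound (M ** Tm - t *\<^sub>R matpow (mexp (t *\<^sub>R A)) j)
       (real j * (t * a) ^ 2 * exp (real j * (t * a)) * (t * exp (t * a))
        + exp (real j * (t * a)) * (t ^ 2 * a * exp (t * a)))"
      using mbound_diff_mult[OF H(3) I(2) E I(3)] by (simp add: matrix_scalar_ac)
    show "0 \<le> l * \<mu>" "l * \<mu> \<le> 1" using H(4,5) I(4,5) \<phi> by (auto simp: mult_le_one)
    show "1 - l * \<mu> \<le> (1 - \<phi>) + real j * (1 - \<epsilon>)"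
      using one_minus_mult_le[of \<phi> l \<mu>] I(4,5) H(5,6) by simp
  qed
qed

lemma zset_Hrep_iterate_Irep_hclose:
  fixes nn :: "real^'n \<Rightarrow> real" and nq :: "real^'q \<Rightarrow> real" and A :: "real^'n^'n"
  assumes nn: "is_norm nn" and nq: "is_norm nq" and t: "t > 0" and tA: "t * opnorm nn nn A \<le> 1"
    and \<epsilon>: "0 \<le> \<epsilon>" "\<epsilon> < 1" and \<phi>: "0 \<le> \<phi>" "\<phi> < 1"
    and A: "mbound A a" and R: "\<forall>b\<in>nball nq. norm (snd U *v b) \<le> R"
  shows "hclose ((real j * (t * a) ^ 2 * exp (real j * (t * a)) * (t * exp (t * a))
          + exp (real j * (t * a)) * (t ^ 2 * a * exp (t * a))) * (norm (fst U) + R)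
       + ((1 - \<phi>) + real j * (1 - \<epsilon>)) * (exp (real j * (t * a)) * (t * exp (t * a)) * R))
     (zset nq ((Hrep nn nq A t \<epsilon> ^^ j) (Irep nn nq A t \<phi> U)))
     ((\<lambda>u. t *\<^sub>R (matpow (mexp (t *\<^sub>R A)) j *v u)) ` zset nq U)"
proof -
  obtain M \<mu> where H: "(Hrep nn nq A t \<epsilon> ^^ j) (Irep nn nq A t \<phi> U) = (M *v fst U, \<mu> *\<^sub>R (M ** snd U))"
    "mbound M (exp (real j * (t * a)) * (t * exp (t * a)))"
    "mbound (M - t *\<^sub>R matpow (mexp (t *\<^sub>R A)) j)
       (real j * (t * a) ^ 2 * exp (real j * (t * a)) * (t * exp (t * a))
        + exp (real j * (t * a)) * (t ^ 2 * a * exp (t * a)))"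
    "0 \<le> \<mu>" "\<mu> \<le> 1" "1 - \<mu> \<le> (1 - \<phi>) + real j * (1 - \<epsilon>)"
    by (rule Hrep_iterate_Irep[OF nn nq t tA \<epsilon> \<phi> A])
  have "hclose ((real j * (t * a) ^ 2 * exp (real j * (t * a)) * (t * exp (t * a))
          + exp (real j * (t * a)) * (t ^ 2 * a * exp (t * a))) * (norm (fst U) + R)
       + (1 - \<mu>) * (exp (real j * (t * a)) * (t * exp (t * a)) * R))
     (zset nq ((Hrep nn nq A t \<epsilon> ^^ j) (Irep nn nq A t \<phi> U)))
     ((\<lambda>u. t *\<^sub>R (matpow (mexp (t *\<^sub>R A)) j *v u)) ` zset nq U)"
    unfolding H(1) using zset_hclose[OF H(3) H(2) R H(4,5), where c = "fst U"]
    by (simp add: scaleR_matrix_vector_assoc[symmetric] mult.assoc)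
  moreover have "(1 - \<mu>) * (exp (real j * (t * a)) * (t * exp (t * a)) * R)
      \<le> ((1 - \<phi>) + real j * (1 - \<epsilon>)) * (exp (real j * (t * a)) * (t * exp (t * a)) * R)"
    using H(6) nball_image_bound_nonneg[OF nq R] t by (intro mult_right_mono) auto
  ultimately show ?thesis by (rule hclose_mono[OF _ add_left_mono])
qed

section \<open>The input reachable set\<close>

lemma measurable_on_subset:
  assumes "f measurable_on S" "T \<subseteq> S" "T \<in> sets lebesgue"
  shows "f measurable_on T"
proof -
  have "(\<lambda>x. if x \<in> S then f x else 0) measurable_on UNIV"
    using assms(1) by (simp only: measurable_on_UNIV)
  then have "(\<lambda>x. if x \<in> T then (if x \<in> S then f x else 0) else 0) measurable_on UNIV"
    using assms(3) by (rule measurable_on_restrict)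
  also have "(\<lambda>x. if x \<in> T then (if x \<in> S then f x else 0) else 0) = (\<lambda>x. if x \<in> T then f x else 0)"
    using assms(2) by (intro ext) auto
  finally show ?thesis by (simp only: measurable_on_UNIV)
qed

lemma measurable_on_extend_const:
  fixes w :: "real \<Rightarrow> 'a::euclidean_space"
  assumes w: "w measurable_on {0..t0}" and t: "0 \<le> t0" "t0 \<le> t1"
  shows "(\<lambda>s. if s \<le> t0 then w s else u) measurable_on {0..t1}"
proof -
  have "(\<lambda>x. if x \<in> {0..t0} then w x else 0) measurable_on UNIV"
    using w by (simp only: measurable_on_UNIV)
  moreover have "(\<lambda>x. if x \<in> {t0<..t1} then u else 0) measurable_on UNIV"
    by (simp only: measurable_on_UNIV) (rule measurable_on_const; simp)
  ultimately have "(\<lambda>x. (if x \<in> {0..t0} then w x else 0) + (if x \<in> {t0<..t1} then u else 0))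
      measurable_on UNIV" by (rule measurable_on_add)
  also have "(\<lambda>x. (if x \<in> {0..t0} then w x else 0) + (if x \<in> {t0<..t1} then u else 0))
      = (\<lambda>x. if x \<in> {0..t1} then (if x \<le> t0 then w x else u) else 0)"
    using t by (intro ext) auto
  finally show ?thesis by (simp only: measurable_on_UNIV)
qed

lemma measurable_on_mexp_mv:
  fixes A :: "real^'n^'n"
  assumes "w measurable_on S" "S \<in> sets lebesgue"
  shows "(\<lambda>s. mexp (s *\<^sub>R A) *v w s) measurable_on S"
proof -
  have "(\<lambda>s. mexp (s *\<^sub>R A)) measurable_on S"
    using continuous_imp_measurable_on[OF continuous_on_mexp] assms(2) measurable_on_subset by blast
  moreover have "bilinear (\<lambda>(M::real^'n^'n) x. M *v x)"
    unfolding bilinear_def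
    by (auto intro!: linearI simp: matrix_vector_mult_add_rdistrib matrix_vector_right_distrib
        scaleR_matrix_vector_assoc matrix_vector_mult_scaleR)
  ultimately show ?thesis using measurable_on_bilinear assms(1) by blast
qed

lemma integrable_bounded_measurable:
  fixes f :: "real \<Rightarrow> real^'n"
  assumes "f measurable_on {a..b}" "\<And>s. s \<in> {a..b} \<Longrightarrow> norm (f s) \<le> B"
  shows "f integrable_on {a..b}"
proof (rule measurable_bounded_by_integrable_imp_integrable)
  show "f \<in> borel_measurable (lebesgue_on {a..b})"
    using assms(1) measurable_on_iff_borel_measurable[of "{a..b}" f] by simp
  show "(\<lambda>x. B) integrable_on {a..b}" by (rule integrable_const_ivl)
qed (use assms in auto)

lemma norm_mexp_mv_le:
  assumes A: "mbound A a" and s: "s \<in> {0..t}" and x: "norm x \<le> K"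
  shows "norm (mexp (s *\<^sub>R A) *v x) \<le> exp (t * a) * K"
proof -
  have "norm (mexp (s *\<^sub>R A) *v x) \<le> exp (\<bar>s\<bar> * a) * norm x" by (rule mboundD[OF mbound_mexp[OF A]])
  also have "\<dots> \<le> exp (t * a) * K"
    using s x mbound_nonneg[OF A] by (intro mult_mono) (auto intro: mult_right_mono)
  finally show ?thesis .
qed

lemma norm_mexp_minus_mv_le:
  assumes A: "mbound A a" and s: "s \<in> {t0..t0 + \<tau>}" and t0: "t0 \<ge> 0" and x: "norm x \<le> K"
  shows "norm ((mexp (s *\<^sub>R A) - mexp (t0 *\<^sub>R A)) *v x) \<le> exp (t0 * a) * (\<tau> * a * exp (\<tau> * a)) * K"
proof -
  have a: "a \<ge> 0" by (rule mbound_nonneg[OF A])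
  have "\<bar>s - t0\<bar> * a * exp (\<bar>s - t0\<bar> * a) \<le> \<tau> * a * exp (\<tau> * a)"
    using s a by (intro mult_mono) (auto intro: mult_right_mono)
  then have "exp (t0 * a) * (\<bar>s - t0\<bar> * a * exp (\<bar>s - t0\<bar> * a)) \<le> exp (t0 * a) * (\<tau> * a * exp (\<tau> * a))"
    by (rule mult_left_mono) simp
  from mult_mono[OF this x] have "exp (\<bar>t0\<bar> * a) * (\<bar>s - t0\<bar> * a * exp (\<bar>s - t0\<bar> * a)) * norm x
      \<le> exp (t0 * a) * (\<tau> * a * exp (\<tau> * a)) * K"
    using t0 s a by simp
  then show ?thesis using mboundD[OF mbound_mexp_diff[OF A]] order_trans by blast
qed

lemma integral_in_convex:
  fixes f :: "real \<Rightarrow> real^'n"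
  assumes S: "convex S" "closed S" and f: "f integrable_on {l..r}" and lr: "l < r"
    and fS: "\<And>s. s \<in> {l..r} \<Longrightarrow> f s \<in> S"
  shows "(1 / (r - l)) *\<^sub>R integral {l..r} f \<in> S"
proof (rule ccontr)
  assume "(1 / (r - l)) *\<^sub>R integral {l..r} f \<notin> S"
  then obtain c d where cd: "c \<bullet> ((1 / (r - l)) *\<^sub>R integral {l..r} f) < d" "\<And>x. x \<in> S \<Longrightarrow> c \<bullet> x > d"
    using separating_hyperplane_closed_point[OF S] by blast
  have "(r - l) * d = integral {l..r} (\<lambda>s. d)" using lr by simp
  also have "\<dots> \<le> integral {l..r} (\<lambda>s. c \<bullet> f s)"
    using cd(2)[OF fS] integrable_linear[OF f bounded_linear_inner_right]
    by (intro integral_le) (auto simp: o_def less_imp_le)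
  also have "\<dots> = c \<bullet> integral {l..r} f"
    using integral_linear[OF f bounded_linear_inner_right] by (simp add: o_def)
  finally show False using cd(1) lr by (simp add: field_simps)
qed

lemma norm_integral_le_ivl:
  fixes f :: "real \<Rightarrow> real^'n"
  assumes f: "f integrable_on {l..r}" and lr: "l \<le> r" and B: "\<And>s. s \<in> {l..r} \<Longrightarrow> norm (f s) \<le> B"
  shows "norm (integral {l..r} f) \<le> (r - l) * B"
proof -
  have "0 \<le> B" using order_trans[OF norm_ge_zero B[of l]] lr by simp
  then have "norm (integral {l..r} f) \<le> B * measure lborel {l..r}"
    using f B by (intro has_integral_bound_real[where S = "{}"]) auto
  then show ?thesis using lr by (simp add: mult.commute)
qed

lemma integrable_on_measurable_bounded_mexp:
  fixes A :: "real^'n^'n"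
  assumes A: "mbound A a" and lr: "0 \<le> l" and w: "w measurable_on {l..r}"
    and K: "\<And>s. s \<in> {l..r} \<Longrightarrow> norm (w s) \<le> K"
  shows "w integrable_on {l..r}" "(\<lambda>s. mexp (s *\<^sub>R A) *v w s) integrable_on {l..r}"
proof -
  show "w integrable_on {l..r}" by (rule integrable_bounded_measurable[OF w K])
  have "norm (mexp (s *\<^sub>R A) *v w s) \<le> exp (r * a) * K" if "s \<in> {l..r}" for s
    using norm_mexp_mv_le[OF A _ K[OF that]] that lr by simp
  then show "(\<lambda>s. mexp (s *\<^sub>R A) *v w s) integrable_on {l..r}"
    by (intro integrable_bounded_measurable measurable_on_mexp_mv w) auto
qed

lemma integral_mexp_mv_freeze:
  fixes A :: "real^'n^'n"
  assumes A: "mbound A a" and t0: "0 \<le> t0" and \<tau>: "0 \<le> \<tau>"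
    and w: "w measurable_on {t0..t0 + \<tau>}" and K: "\<And>s. s \<in> {t0..t0 + \<tau>} \<Longrightarrow> norm (w s) \<le> K"
  shows "norm (integral {t0..t0 + \<tau>} (\<lambda>s. mexp (s *\<^sub>R A) *v w s) - mexp (t0 *\<^sub>R A) *v integral {t0..t0 + \<tau>} w)
    \<le> \<tau> * (exp (t0 * a) * (\<tau> * a * exp (\<tau> * a)) * K)"
proof -
  note wi = integrable_on_measurable_bounded_mexp(1)[OF A t0 w K]
  note gi = integrable_on_measurable_bounded_mexp(2)[OF A t0 w K]
  have lin: "bounded_linear ((*v) (mexp (t0 *\<^sub>R A)))" by (rule matrix_vector_mul_bounded_linear)
  have li: "(\<lambda>s. mexp (t0 *\<^sub>R A) *v w s) integrable_on {t0..t0 + \<tau>}"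
    using integrable_linear[OF wi lin] by (simp add: o_def)
  have "mexp (t0 *\<^sub>R A) *v integral {t0..t0 + \<tau>} w = integral {t0..t0 + \<tau>} (\<lambda>s. mexp (t0 *\<^sub>R A) *v w s)"
    using integral_linear[OF wi lin] by (simp add: o_def)
  then have "integral {t0..t0 + \<tau>} (\<lambda>s. mexp (s *\<^sub>R A) *v w s) - mexp (t0 *\<^sub>R A) *v integral {t0..t0 + \<tau>} w
      = integral {t0..t0 + \<tau>} (\<lambda>s. (mexp (s *\<^sub>R A) - mexp (t0 *\<^sub>R A)) *v w s)"
    using integral_diff[OF gi li] by (simp add: matrix_vector_mult_diff_rdistrib)
  also have "norm \<dots> \<le> ((t0 + \<tau>) - t0) * (exp (t0 * a) * (\<tau> * a * exp (\<tau> * a)) * K)"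
    using integrable_diff[OF gi li] \<tau> norm_mexp_minus_mv_le[OF A _ t0 K]
    by (intro norm_integral_le_ivl) (simp_all add: matrix_vector_mult_diff_rdistrib)
  finally show ?thesis by simp
qed

lemma Ru_extend:
  fixes A :: "real^'n^'n"
  assumes A: "mbound A a" and \<tau>: "\<tau> > 0" and t0: "t0 \<ge> 0"
    and K: "\<And>u. u \<in> U \<Longrightarrow> norm u \<le> K" and u: "u \<in> U" and z': "z' \<in> Ru A U t0"
  shows "\<exists>z\<in>Ru A U (t0 + \<tau>).
    norm (z - (z' + \<tau> *\<^sub>R (mexp (t0 *\<^sub>R A) *v u))) \<le> \<tau> * (exp (t0 * a) * (\<tau> * a * exp (\<tau> * a)) * K)"
proof -
  obtain w' where z'_eq: "z' = integral {0..t0} (\<lambda>s. mexp (s *\<^sub>R A) *v w' s)"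
    and w': "w' measurable_on {0..t0}" "\<forall>s\<in>{0..t0}. w' s \<in> U"
    using z' unfolding Ru_def by blast
  define w where "w s = (if s \<le> t0 then w' s else u)" for s
  define g where "g s = mexp (s *\<^sub>R A) *v w s" for s
  have wm: "w measurable_on {0..t0 + \<tau>}"
    unfolding w_def using w'(1) t0 \<tau> by (intro measurable_on_extend_const) auto
  have wU: "\<forall>s\<in>{0..t0 + \<tau>}. w s \<in> U" unfolding w_def using w'(2) u by auto
  then have wK: "norm (w s) \<le> K" if "s \<in> {0..t0 + \<tau>}" for s using K that by blast
  have wm2: "w measurable_on {t0..t0 + \<tau>}"
    using measurable_on_subset[OF wm] t0 by auto
  have z: "integral {0..t0 + \<tau>} g \<in> Ru A U (t0 + \<tau>)" unfolding Ru_def g_def using wm wU by blast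
  have "integral {0..t0 + \<tau>} g = integral {0..t0} g + integral {t0..t0 + \<tau>} g"
    using Henstock_Kurzweil_Integration.integral_combine[OF t0 _ integrable_on_measurable_bounded_mexp(2)[OF A _ wm wK]]
      \<tau> unfolding g_def by simp
  moreover have "integral {0..t0} g = z'"
    unfolding z'_eq g_def w_def by (rule integral_cong) auto
  moreover have "integral {t0..t0 + \<tau>} w = \<tau> *\<^sub>R u"
  proof -
    have "integral {t0..t0 + \<tau>} w = integral {t0..t0 + \<tau>} (\<lambda>s. u)"
      by (rule integral_spike[where S = "{t0}"]) (auto simp: w_def)
    then show ?thesis using \<tau> by simp
  qed
  moreover have "norm (integral {t0..t0 + \<tau>} g - mexp (t0 *\<^sub>R A) *v integral {t0..t0 + \<tau>} w)
      \<le> \<tau> * (exp (t0 * a) * (\<tau> * a * exp (\<tau> * a)) * K)"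
    unfolding g_def using t0 \<tau> wK by (intro integral_mexp_mv_freeze[OF A _ _ wm2]) auto
  ultimately show ?thesis using z
    by (intro bexI[of _ "integral {0..t0 + \<tau>} g"]) (simp_all add: algebra_simps)
qed

lemma Ru_split:
  fixes A :: "real^'n^'n"
  assumes A: "mbound A a" and \<tau>: "\<tau> > 0" and t0: "t0 \<ge> 0" and U: "convex U" "closed U"
    and K: "\<And>u. u \<in> U \<Longrightarrow> norm u \<le> K" and z: "z \<in> Ru A U (t0 + \<tau>)"
  obtains z' ub where "z' \<in> Ru A U t0" "ub \<in> U"
    "norm (z - (z' + \<tau> *\<^sub>R (mexp (t0 *\<^sub>R A) *v ub))) \<le> \<tau> * (exp (t0 * a) * (\<tau> * a * exp (\<tau> * a)) * K)"
proof -
  obtain w where z_eq: "z = integral {0..t0 + \<tau>} (\<lambda>s. mexp (s *\<^sub>R A) *v w s)"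
    and wm: "w measurable_on {0..t0 + \<tau>}" and wU: "\<forall>s\<in>{0..t0 + \<tau>}. w s \<in> U"
    using z unfolding Ru_def by blast
  define g where "g s = mexp (s *\<^sub>R A) *v w s" for s
  have wK: "norm (w s) \<le> K" if "s \<in> {0..t0 + \<tau>}" for s using K wU that by blast
  have wm1: "w measurable_on {0..t0}" and wm2: "w measurable_on {t0..t0 + \<tau>}"
    using measurable_on_subset[OF wm] t0 \<tau> by auto
  have wK2: "norm (w s) \<le> K" if "s \<in> {t0..t0 + \<tau>}" for s using wK that t0 by simp
  define ub where "ub = (1 / \<tau>) *\<^sub>R integral {t0..t0 + \<tau>} w"
  have "(1 / ((t0 + \<tau>) - t0)) *\<^sub>R integral {t0..t0 + \<tau>} w \<in> U"
    using wU t0 \<tau> by (intro integral_in_convex[OF U integrable_on_measurable_bounded_mexp(1)[OF A t0 wm2 wK2]]) auto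
  then have "ub \<in> U" unfolding ub_def by simp
  moreover have "integral {0..t0} g \<in> Ru A U t0" unfolding Ru_def g_def using wm1 wU t0 \<tau> by auto
  moreover have "z = integral {0..t0} g + integral {t0..t0 + \<tau>} g"
    using Henstock_Kurzweil_Integration.integral_combine[OF t0 _ integrable_on_measurable_bounded_mexp(2)[OF A _ wm wK]]
      \<tau> unfolding z_eq g_def by simp
  moreover have "\<tau> *\<^sub>R ub = integral {t0..t0 + \<tau>} w" unfolding ub_def using \<tau> by simp
  moreover have "norm (integral {t0..t0 + \<tau>} g - mexp (t0 *\<^sub>R A) *v integral {t0..t0 + \<tau>} w)
      \<le> \<tau> * (exp (t0 * a) * (\<tau> * a * exp (\<tau> * a)) * K)"
    unfolding g_def using t0 \<tau> by (intro integral_mexp_mv_freeze[OF A _ _ wm2 wK2]) auto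
  ultimately show ?thesis
    by (intro that[of "integral {0..t0} g" ub]) (simp_all add: matrix_vector_mult_scaleR[symmetric])
qed

lemma Ru_step_hclose:
  fixes A :: "real^'n^'n"
  assumes A: "mbound A a" and \<tau>: "\<tau> > 0" and t0: "t0 \<ge> 0" and U: "convex U" "closed U"
    and K: "\<And>u. u \<in> U \<Longrightarrow> norm u \<le> K"
  shows "hclose (\<tau> * (exp (t0 * a) * (\<tau> * a * exp (\<tau> * a)) * K))
    (msum (Ru A U t0) ((\<lambda>u. \<tau> *\<^sub>R (mexp (t0 *\<^sub>R A) *v u)) ` U)) (Ru A U (t0 + \<tau>))"
  unfolding hclose_def
proof (intro conjI ballI)
  fix x assume "x \<in> msum (Ru A U t0) ((\<lambda>u. \<tau> *\<^sub>R (mexp (t0 *\<^sub>R A) *v u)) ` U)"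
  then obtain z' u where "x = z' + \<tau> *\<^sub>R (mexp (t0 *\<^sub>R A) *v u)" "z' \<in> Ru A U t0" "u \<in> U"
    unfolding msum_def by blast
  then show "\<exists>z\<in>Ru A U (t0 + \<tau>). norm (x - z) \<le> \<tau> * (exp (t0 * a) * (\<tau> * a * exp (\<tau> * a)) * K)"
    using Ru_extend[OF A \<tau> t0 K] by (metis norm_minus_commute)
next
  fix z assume "z \<in> Ru A U (t0 + \<tau>)"
  then obtain z' ub where "z' \<in> Ru A U t0" "ub \<in> U"
    "norm (z - (z' + \<tau> *\<^sub>R (mexp (t0 *\<^sub>R A) *v ub))) \<le> \<tau> * (exp (t0 * a) * (\<tau> * a * exp (\<tau> * a)) * K)"
    using Ru_split[OF A \<tau> t0 U K] by metis
  then show "\<exists>x\<in>msum (Ru A U t0) ((\<lambda>u. \<tau> *\<^sub>R (mexp (t0 *\<^sub>R A) *v u)) ` U).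
      norm (x - z) \<le> \<tau> * (exp (t0 * a) * (\<tau> * a * exp (\<tau> * a)) * K)"
    unfolding msum_def by (intro bexI[of _ "z' + \<tau> *\<^sub>R (mexp (t0 *\<^sub>R A) *v ub)"]) (auto simp: norm_minus_commute)
qed

lemma Ru_zero: "U \<noteq> {} \<Longrightarrow> Ru A U 0 = {0}"
  unfolding Ru_def by (auto intro!: exI[of _ "\<lambda>_. SOME u. u \<in> U"] some_in_eq[THEN iffD2])

fun Rsum :: "real^'n^'n \<Rightarrow> real \<Rightarrow> (real^'n) set \<Rightarrow> nat \<Rightarrow> (real^'n) set" where
  "Rsum E t U 0 = {0}"
| "Rsum E t U (Suc i) = msum (Rsum E t U i) ((\<lambda>u. t *\<^sub>R (matpow E i *v u)) ` U)"

lemma Rsum_Ru_hclose: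
  fixes A :: "real^'n^'n"
  assumes A: "mbound A a" and \<tau>: "\<tau> > 0" and U: "convex U" "closed U" "U \<noteq> {}"
    and K: "\<And>u. u \<in> U \<Longrightarrow> norm u \<le> K"
  shows "real i * \<tau> \<le> T \<Longrightarrow>
    hclose (real i * (\<tau> * (exp (T * a) * (\<tau> * a) * K))) (Rsum (mexp (\<tau> *\<^sub>R A)) \<tau> U i) (Ru A U (real i * \<tau>))"
proof (induct i)
  case 0
  then show ?case using Ru_zero[OF U(3)] by (simp add: hclose_refl)
next
  case (Suc i)
  define t0 where "t0 = real i * \<tau>"
  have a: "a \<ge> 0" by (rule mbound_nonneg[OF A])
  have K0: "K \<ge> 0" using U(3) K norm_ge_zero order_trans by blast
  have t0: "t0 \<ge> 0" "t0 + \<tau> \<le> T" using Suc(2) \<tau> unfolding t0_def by (simp_all add: algebra_simps)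
  have "hclose (real i * (\<tau> * (exp (T * a) * (\<tau> * a) * K)) + 0)
      (Rsum (mexp (\<tau> *\<^sub>R A)) \<tau> U (Suc i)) (msum (Ru A U t0) ((\<lambda>u. \<tau> *\<^sub>R (mexp (t0 *\<^sub>R A) *v u)) ` U))"
    unfolding Rsum.simps t0_def mexp_mult_of_nat
    using Suc t0 \<tau> by (intro hclose_msum hclose_refl Suc(1)) (simp add: t0_def)
  moreover have "hclose (\<tau> * (exp (t0 * a) * (\<tau> * a * exp (\<tau> * a)) * K))
      (msum (Ru A U t0) ((\<lambda>u. \<tau> *\<^sub>R (mexp (t0 *\<^sub>R A) *v u)) ` U)) (Ru A U (t0 + \<tau>))"
    by (rule Ru_step_hclose[OF A \<tau> t0(1) U(1,2) K])
  moreover have "\<tau> * (exp (t0 * a) * (\<tau> * a * exp (\<tau> * a)) * K) \<le> \<tau> * (exp (T * a) * (\<tau> * a) * K)"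
  proof -
    have "exp (t0 * a) * exp (\<tau> * a) \<le> exp (T * a)"
      using mult_right_mono[OF t0(2) a] by (simp add: exp_add[symmetric] algebra_simps)
    then have "exp (t0 * a) * exp (\<tau> * a) * (\<tau> * a * K) \<le> exp (T * a) * (\<tau> * a * K)"
      using \<tau> a K0 by (intro mult_right_mono) auto
    then show ?thesis using \<tau> by (intro mult_left_mono) (simp_all add: ac_simps)
  qed
  ultimately show ?case
    unfolding t0_def by (auto simp: algebra_simps intro: hclose_mono dest: hclose_trans)
qed

lemma Wset_Rsum_hclose:
  assumes "\<And>j. j < i \<Longrightarrow> hclose \<delta> (zset nq (Vrep nn nq A T N U j))
       ((\<lambda>u. (T / real N) *\<^sub>R (matpow (mexp ((T / real N) *\<^sub>R A)) j *v u)) ` zset nq U)"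
  shows "hclose (real i * \<delta>) (Wset nn nq A T N U i) (Rsum (mexp ((T / real N) *\<^sub>R A)) (T / real N) (zset nq U) i)"
  using assms
proof (induct i)
  case (Suc i)
  then have "hclose (real i * \<delta> + \<delta>) (Wset nn nq A T N U (Suc i))
      (Rsum (mexp ((T / real N) *\<^sub>R A)) (T / real N) (zset nq U) (Suc i))"
    unfolding Wset.simps Rsum.simps by (intro hclose_msum) auto
  then show ?case by (simp add: algebra_simps)
qed (simp add: hclose_refl)

lemma Ru_restrict:
  fixes A :: "real^'n^'n"
  assumes A: "mbound A a" and s: "0 \<le> s" "s \<le> t" and K: "\<And>u. u \<in> U \<Longrightarrow> norm u \<le> K"
    and z: "z \<in> Ru A U t"
  shows "\<exists>z'\<in>Ru A U s. norm (z - z') \<le> (t - s) * (exp (t * a) * K)"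
proof -
  obtain w where z_eq: "z = integral {0..t} (\<lambda>s. mexp (s *\<^sub>R A) *v w s)"
    and w: "w measurable_on {0..t}" and wU: "\<forall>s\<in>{0..t}. w s \<in> U"
    using z unfolding Ru_def by blast
  define g where "g s = mexp (s *\<^sub>R A) *v w s" for s
  have wK: "norm (w \<sigma>) \<le> K" if "\<sigma> \<in> {0..t}" for \<sigma> using K wU that by blast
  have gi: "g integrable_on {0..t}"
    unfolding g_def by (rule integrable_on_measurable_bounded_mexp(2)[OF A order_refl w wK])
  have "integral {0..s} g \<in> Ru A U s"
    unfolding Ru_def g_def using measurable_on_subset[OF w] wU s by auto
  moreover have "integral {0..s} g + integral {s..t} g = z"
    using Henstock_Kurzweil_Integration.integral_combine[OF s gi] unfolding z_eq g_def by simp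
  then have "z - integral {0..s} g = integral {s..t} g" by (metis add_diff_cancel_left')
  moreover have "norm (integral {s..t} g) \<le> (t - s) * (exp (t * a) * K)"
    using integrable_subinterval_real[OF gi] s norm_mexp_mv_le[OF A _ wK]
    by (intro norm_integral_le_ivl) (auto simp: g_def)
  ultimately show ?thesis by metis
qed

lemma Rt_shift:
  fixes A :: "real^'n^'n"
  assumes A: "mbound A a" and t0: "0 \<le> t0" "t0 \<le> t" and K0: "\<And>x. x \<in> X \<Longrightarrow> norm x \<le> K0"
    and Ku: "\<And>u. u \<in> U \<Longrightarrow> norm u \<le> Ku" and z: "z \<in> Rt A X U t"
  shows "\<exists>z'\<in>Rt A X U t0. norm (z - z') \<le> (t - t0) * (a * exp (t * a) * K0 + exp (t * a) * Ku)"
proof -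
  obtain x0 y where z_eq: "z = mexp (t *\<^sub>R A) *v x0 + y" and x0: "x0 \<in> X" and y: "y \<in> Ru A U t"
    using z unfolding Rt_def msum_def Rh_def by blast
  obtain y' where y': "y' \<in> Ru A U t0" "norm (y - y') \<le> (t - t0) * (exp (t * a) * Ku)"
    using Ru_restrict[OF A t0 Ku y] by blast
  have "norm ((mexp (t *\<^sub>R A) - mexp (t0 *\<^sub>R A)) *v x0)
      \<le> exp (t0 * a) * ((t - t0) * a * exp ((t - t0) * a)) * K0"
    using t0 by (intro norm_mexp_minus_mv_le[OF A _ t0(1) K0[OF x0]]) simp
  also have "\<dots> = (t - t0) * (a * exp (t * a) * K0)"
    by (simp add: exp_add[symmetric] algebra_simps)
  finally have "norm (z - (mexp (t0 *\<^sub>R A) *v x0 + y')) \<le> (t - t0) * (a * exp (t * a) * K0 + exp (t * a) * Ku)"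
    using y'(2) norm_triangle_ineq[of "(mexp (t *\<^sub>R A) - mexp (t0 *\<^sub>R A)) *v x0" "y - y'"]
    unfolding z_eq by (simp add: algebra_simps)
  moreover have "mexp (t0 *\<^sub>R A) *v x0 + y' \<in> Rt A X U t0"
    unfolding Rt_def msum_def Rh_def using x0 y'(1) by blast
  ultimately show ?thesis by blast
qed

lemma nat_floor_divide_bounds:
  assumes \<tau>: "\<tau> > 0" and t: "0 \<le> t" "t \<le> real N * \<tau>"
  shows "real (nat \<lfloor>t / \<tau>\<rfloor>) * \<tau> \<le> t" "t - real (nat \<lfloor>t / \<tau>\<rfloor>) * \<tau> \<le> \<tau>" "nat \<lfloor>t / \<tau>\<rfloor> \<le> N"
proof -
  have r: "real (nat \<lfloor>t / \<tau>\<rfloor>) = of_int \<lfloor>t / \<tau>\<rfloor>" using t \<tau> by simp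
  show "real (nat \<lfloor>t / \<tau>\<rfloor>) * \<tau> \<le> t" unfolding r using of_int_floor_le[of "t / \<tau>"] \<tau>
    by (simp add: le_divide_eq)
  have "t < (of_int \<lfloor>t / \<tau>\<rfloor> + 1) * \<tau>"
    using real_of_int_floor_add_one_gt[of "t / \<tau>"] pos_divide_less_eq[OF \<tau>] by blast
  then show "t - real (nat \<lfloor>t / \<tau>\<rfloor>) * \<tau> \<le> \<tau>" unfolding r by (simp add: algebra_simps)
  have "t / \<tau> \<le> real N" using t \<tau> by (simp add: divide_le_eq)
  then show "nat \<lfloor>t / \<tau>\<rfloor> \<le> N" by (simp add: nat_le_iff floor_le_iff)
qed

lemma Rint_hclose:
  fixes A :: "real^'n^'n"
  assumes A: "mbound A a" and \<tau>: "\<tau> > 0" and T: "T = real N * \<tau>"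
    and K0: "0 \<le> K0" "\<And>x. x \<in> X \<Longrightarrow> norm x \<le> K0" and Ku: "0 \<le> Ku" "\<And>u. u \<in> U \<Longrightarrow> norm u \<le> Ku"
    and L: "\<And>i. i \<le> N \<Longrightarrow> hclose d (L i) (Rt A X U (real i * \<tau>))"
  shows "hclose (d + \<tau> * (a * exp (T * a) * K0 + exp (T * a) * Ku)) (\<Union>i\<in>{0..N}. L i) (Rint A X U T)"
  unfolding hclose_def
proof (intro conjI ballI)
  have a: "a \<ge> 0" by (rule mbound_nonneg[OF A])
  then have shift0: "0 \<le> \<tau> * (a * exp (T * a) * K0 + exp (T * a) * Ku)" using \<tau> K0 Ku by simp
  fix x assume "x \<in> (\<Union>i\<in>{0..N}. L i)"
  then obtain i where i: "i \<le> N" "x \<in> L i" by auto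
  then obtain y where y: "y \<in> Rt A X U (real i * \<tau>)" "norm (x - y) \<le> d"
    using L[OF i(1)] unfolding hclose_def by blast
  have "real i * \<tau> \<in> {0..T}" using i(1) \<tau> T by (auto intro: mult_right_mono)
  then show "\<exists>y\<in>Rint A X U T. norm (x - y) \<le> d + \<tau> * (a * exp (T * a) * K0 + exp (T * a) * Ku)"
    using y shift0 unfolding Rint_def by force
next
  have a: "a \<ge> 0" by (rule mbound_nonneg[OF A])
  fix z assume "z \<in> Rint A X U T"
  then obtain t where t: "t \<in> {0..T}" "z \<in> Rt A X U t" unfolding Rint_def by blast
  define i where "i = nat \<lfloor>t / \<tau>\<rfloor>"
  have "0 \<le> t" "t \<le> real N * \<tau>" using t(1) T by auto
  then have i: "real i * \<tau> \<le> t" "t - real i * \<tau> \<le> \<tau>" "i \<le> N"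
    unfolding i_def by (rule nat_floor_divide_bounds[OF \<tau>])+
  obtain z' where z': "z' \<in> Rt A X U (real i * \<tau>)"
    "norm (z - z') \<le> (t - real i * \<tau>) * (a * exp (t * a) * K0 + exp (t * a) * Ku)"
    using Rt_shift[OF A _ i(1) K0(2) Ku(2) t(2)] \<tau> by auto
  have "exp (t * a) \<le> exp (T * a)" using t(1) a by (simp add: mult_right_mono)
  then have "(t - real i * \<tau>) * (a * exp (t * a) * K0 + exp (t * a) * Ku)
      \<le> \<tau> * (a * exp (T * a) * K0 + exp (T * a) * Ku)"
    using i(1,2) a K0 Ku by (intro mult_mono add_mono mult_left_mono mult_right_mono) auto
  moreover obtain x where "x \<in> L i" "norm (x - z') \<le> d"
    using L[OF i(3)] z'(1) unfolding hclose_def by blast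
  ultimately show "\<exists>x\<in>\<Union>i\<in>{0..N}. L i. norm (x - z) \<le> d + \<tau> * (a * exp (T * a) * K0 + exp (T * a) * Ku)"
    using z'(2) i(3) norm_triangle_ineq[of "x - z'" "z' - z"]
    by (intro bexI[of _ x]) (auto simp: norm_minus_commute)
qed

section \<open>Convergence of the scheme\<close>

lemma uniform_grid_bounds:
  assumes T: "T > 0" and N: "1 \<le> N" and j: "j \<le> N"
  shows "0 < T / real N" "real j * (T / real N) \<le> T"
    "real j * (1 - (1 - 1 / real N ^ 2)) \<le> (T / real N) / T"
proof -
  show "0 < T / real N" using T N by simp
  have "real j * (T / real N) \<le> real N * (T / real N)" using j T by (intro mult_right_mono) auto
  then show "real j * (T / real N) \<le> T" using N by simp
  have "real j * (1 - (1 - 1 / real N ^ 2)) = real j * (1 / real N ^ 2)" by simp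
  also have "\<dots> \<le> real N * (1 / real N ^ 2)" using j by (intro mult_right_mono) auto
  also have "\<dots> = (T / real N) / T" using N T by (simp add: power2_eq_square)
  finally show "real j * (1 - (1 - 1 / real N ^ 2)) \<le> (T / real N) / T" .
qed

lemma Srep_hclose:
  fixes nn :: "real^'n \<Rightarrow> real" and np :: "real^'p \<Rightarrow> real" and A :: "real^'n^'n"
  assumes nn: "is_norm nn" and np: "is_norm np" and T: "T > 0"
  obtains D where "0 \<le> D" "\<And>N i. 1 \<le> N \<Longrightarrow> i \<le> N \<Longrightarrow>
    hclose (D * (T / real N)) (zset np (Srep nn np A T N X0 i)) (Rh A (zset np X0) (real i * (T / real N)))"
proof -
  define a where "a = onorm ((*v) A)"
  have A: "mbound A a" unfolding a_def by (rule mbound_onorm)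
  have a: "0 \<le> a" by (rule mbound_nonneg[OF A])
  obtain R where R: "0 \<le> R" "\<forall>b\<in>nball np. norm (snd X0 *v b) \<le> R" by (rule nball_image_bound[OF np])
  define K where "K = norm (fst X0) + R"
  define E where "E = exp (T * a)"
  have K: "0 \<le> K" unfolding K_def using R by simp
  show thesis
  proof (rule that[of "T * a ^ 2 * E * K + E * R / T"])
    show "0 \<le> T * a ^ 2 * E * K + E * R / T" using T K R by (simp add: E_def)
    fix N i :: nat assume N: "1 \<le> N" and i: "i \<le> N"
    define \<tau> where "\<tau> = T / real N"
    note grid = uniform_grid_bounds[OF T N i, folded \<tau>_def]
    have \<epsilon>: "0 \<le> 1 - 1 / real N ^ 2" "1 - 1 / real N ^ 2 < 1" using N by (simp_all add: power_le_one)
    have c: "hclose (real i * (\<tau> * a) ^ 2 * exp (real i * (\<tau> * a)) * K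
        + real i * (1 - (1 - 1 / real N ^ 2)) * (exp (real i * (\<tau> * a)) * R))
        (zset np (Srep nn np A T N X0 i)) (Rh A (zset np X0) (real i * \<tau>))"
      unfolding Srep_def \<tau>_def[symmetric] K_def
      using zset_Hrep_iterate_hclose[OF nn np _ \<epsilon> A R(2)] grid(1) by simp
    have e: "exp (real i * (\<tau> * a)) \<le> E"
      using mult_right_mono[OF grid(2) a] by (simp add: E_def mult.assoc)
    have "(real i * \<tau>) * (a ^ 2 * exp (real i * (\<tau> * a)) * K) \<le> T * (a ^ 2 * E * K)"
      using grid(2) e K T by (intro mult_mono mult_right_mono mult_left_mono) auto
    then have "\<tau> * ((real i * \<tau>) * (a ^ 2 * exp (real i * (\<tau> * a)) * K)) \<le> \<tau> * (T * (a ^ 2 * E * K))"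
      using grid(1) by (intro mult_left_mono) auto
    then have 1: "real i * (\<tau> * a) ^ 2 * exp (real i * (\<tau> * a)) * K \<le> \<tau> * (T * a ^ 2 * E * K)"
      by (simp add: power2_eq_square mult_ac)
    have 2: "real i * (1 - (1 - 1 / real N ^ 2)) * (exp (real i * (\<tau> * a)) * R) \<le> \<tau> / T * (E * R)"
      using grid(1,3) e R(1) T by (intro mult_mono) (auto simp: E_def)
    have "(T * a ^ 2 * E * K + E * R / T) * \<tau> = \<tau> * (T * a ^ 2 * E * K) + \<tau> / T * (E * R)"
      by (simp add: algebra_simps)
    with 1 2 show "hclose ((T * a ^ 2 * E * K + E * R / T) * (T / real N))
        (zset np (Srep nn np A T N X0 i)) (Rh A (zset np X0) (real i * (T / real N)))"
      unfolding \<tau>_def[symmetric] by (intro hclose_mono[OF c]) linarith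
  qed
qed

lemma Vrep_error_le:
  fixes \<tau> T a K R p :: real
  assumes \<tau>: "0 < \<tau>" and T: "0 < T" and a: "0 \<le> a" and K: "0 \<le> K" and R: "0 \<le> R"
    and jT: "real j * \<tau> + \<tau> \<le> T" and p: "p \<le> 2 * (\<tau> / T)"
  shows "(real j * (\<tau> * a) ^ 2 * exp (real j * (\<tau> * a)) * (\<tau> * exp (\<tau> * a))
          + exp (real j * (\<tau> * a)) * (\<tau> ^ 2 * a * exp (\<tau> * a))) * K
       + p * (exp (real j * (\<tau> * a)) * (\<tau> * exp (\<tau> * a)) * R)
     \<le> \<tau> ^ 2 * ((T * a ^ 2 + a) * exp (T * a) * K + 2 * exp (T * a) * R / T)"
proof -
  define E where "E = exp (T * a)"
  define e where "e = exp (real j * (\<tau> * a)) * exp (\<tau> * a)"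
  have e: "e \<le> E"
    using mult_right_mono[OF jT a] unfolding e_def E_def by (simp add: exp_add[symmetric] algebra_simps)
  have "real j * (\<tau> * a) ^ 2 * exp (real j * (\<tau> * a)) * (\<tau> * exp (\<tau> * a))
      + exp (real j * (\<tau> * a)) * (\<tau> ^ 2 * a * exp (\<tau> * a))
      = \<tau> ^ 2 * ((real j * \<tau>) * a ^ 2 * e + a * e)"
    unfolding e_def by (simp add: power2_eq_square algebra_simps)
  also have "\<dots> \<le> \<tau> ^ 2 * (T * a ^ 2 * E + a * E)"
    using jT \<tau> T e a by (intro mult_left_mono add_mono mult_mono mult_right_mono) (auto simp: e_def)
  finally have 1: "(real j * (\<tau> * a) ^ 2 * exp (real j * (\<tau> * a)) * (\<tau> * exp (\<tau> * a))
      + exp (real j * (\<tau> * a)) * (\<tau> ^ 2 * a * exp (\<tau> * a))) * K \<le> \<tau> ^ 2 * (T * a ^ 2 * E + a * E) * K"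
    using K by (rule mult_right_mono)
  have "\<tau> * (e * R) \<le> \<tau> * (E * R)"
    using mult_right_mono[OF e R] \<tau> by (intro mult_left_mono) auto
  then have "exp (real j * (\<tau> * a)) * (\<tau> * exp (\<tau> * a)) * R \<le> \<tau> * (E * R)"
    unfolding e_def by (simp add: mult_ac)
  with p have 2: "p * (exp (real j * (\<tau> * a)) * (\<tau> * exp (\<tau> * a)) * R) \<le> 2 * (\<tau> / T) * (\<tau> * (E * R))"
    by (rule mult_mono) (use \<tau> T R in auto)
  have "\<tau> ^ 2 * ((T * a ^ 2 + a) * E * K + 2 * E * R / T)
      = \<tau> ^ 2 * (T * a ^ 2 * E + a * E) * K + 2 * (\<tau> / T) * (\<tau> * (E * R))"
    by (simp add: power2_eq_square algebra_simps)
  with 1 2 show ?thesis unfolding E_def by linarith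
qed

lemma Vrep_hclose:
  fixes nn :: "real^'n \<Rightarrow> real" and nq :: "real^'q \<Rightarrow> real" and A :: "real^'n^'n"
  assumes nn: "is_norm nn" and nq: "is_norm nq" and T: "T > 0" and A: "mbound A a"
    and R: "\<forall>b\<in>nball nq. norm (snd U *v b) \<le> R"
    and N: "1 \<le> N" and tA: "T / real N * opnorm nn nn A \<le> 1" and j: "j < N"
  shows "hclose ((T / real N) ^ 2 * ((T * a ^ 2 + a) * exp (T * a) * (norm (fst U) + R) + 2 * exp (T * a) * R / T))
     (zset nq (Vrep nn nq A T N U j))
     ((\<lambda>u. (T / real N) *\<^sub>R (matpow (mexp ((T / real N) *\<^sub>R A)) j *v u)) ` zset nq U)"
proof -
  define \<tau> where "\<tau> = T / real N"
  have R0: "0 \<le> R" by (rule nball_image_bound_nonneg[OF nq R])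
  note grid = uniform_grid_bounds[OF T N less_imp_le[OF j], folded \<tau>_def]
  have jT: "real j * \<tau> + \<tau> \<le> T"
    using uniform_grid_bounds(2)[OF T N, of "Suc j"] j unfolding \<tau>_def by (simp add: algebra_simps add_divide_distrib)
  have p: "(1 - (1 - 1 / real N)) + real j * (1 - (1 - 1 / real N ^ 2)) \<le> 2 * (\<tau> / T)"
    using grid(3) T unfolding \<tau>_def by simp
  have \<epsilon>: "0 \<le> 1 - 1 / real N ^ 2" "1 - 1 / real N ^ 2 < 1"
    and \<phi>: "0 \<le> 1 - 1 / real N" "1 - 1 / real N < 1" using N by (simp_all add: power_le_one)
  have "hclose ((real j * (\<tau> * a) ^ 2 * exp (real j * (\<tau> * a)) * (\<tau> * exp (\<tau> * a))
          + exp (real j * (\<tau> * a)) * (\<tau> ^ 2 * a * exp (\<tau> * a))) * (norm (fst U) + R)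
       + ((1 - (1 - 1 / real N)) + real j * (1 - (1 - 1 / real N ^ 2)))
          * (exp (real j * (\<tau> * a)) * (\<tau> * exp (\<tau> * a)) * R))
     (zset nq (Vrep nn nq A T N U j))
     ((\<lambda>u. \<tau> *\<^sub>R (matpow (mexp (\<tau> *\<^sub>R A)) j *v u)) ` zset nq U)"
    unfolding Vrep_def \<tau>_def[symmetric]
    by (rule zset_Hrep_iterate_Irep_hclose[OF nn nq grid(1) tA[folded \<tau>_def] \<epsilon> \<phi> A R])
  then show ?thesis unfolding \<tau>_def[symmetric]
    by (rule hclose_mono[OF _ Vrep_error_le[OF grid(1) T mbound_nonneg[OF A] _ R0 jT p]]) (simp add: R0)
qed

lemma Wset_hclose:
  fixes nn :: "real^'n \<Rightarrow> real" and nq :: "real^'q \<Rightarrow> real" and A :: "real^'n^'n"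
  assumes nn: "is_norm nn" and nq: "is_norm nq" and T: "T > 0"
  obtains D where "0 \<le> D" "\<And>N i. 1 \<le> N \<Longrightarrow> T / real N * opnorm nn nn A \<le> 1 \<Longrightarrow> i \<le> N \<Longrightarrow>
    hclose (D * (T / real N)) (Wset nn nq A T N U i) (Ru A (zset nq U) (real i * (T / real N)))"
proof -
  define a where "a = onorm ((*v) A)"
  have A: "mbound A a" unfolding a_def by (rule mbound_onorm)
  have a: "0 \<le> a" by (rule mbound_nonneg[OF A])
  obtain R where R: "0 \<le> R" "\<forall>b\<in>nball nq. norm (snd U *v b) \<le> R" by (rule nball_image_bound[OF nq])
  define K where "K = norm (fst U) + R"
  define E where "E = exp (T * a)"
  define DV where "DV = (T * a ^ 2 + a) * E * K + 2 * E * R / T"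
  have K: "0 \<le> K" unfolding K_def using R by simp
  have DV: "0 \<le> DV" unfolding DV_def E_def using T a K R by simp
  show thesis
  proof (rule that[of "T * DV + T * (E * a * K)"])
    show "0 \<le> T * DV + T * (E * a * K)" using T DV a K by (simp add: E_def)
    fix N i :: nat assume N: "1 \<le> N" and tA: "T / real N * opnorm nn nn A \<le> 1" and i: "i \<le> N"
    define \<tau> where "\<tau> = T / real N"
    note grid = uniform_grid_bounds[OF T N i, folded \<tau>_def]
    have UK: "\<And>u. u \<in> zset nq U \<Longrightarrow> norm u \<le> K" unfolding K_def using norm_zset_le[OF R(2)] .
    have c1: "hclose (real i * (\<tau> ^ 2 * DV)) (Wset nn nq A T N U i) (Rsum (mexp (\<tau> *\<^sub>R A)) \<tau> (zset nq U) i)"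
      unfolding \<tau>_def DV_def K_def E_def
      using i by (intro Wset_Rsum_hclose Vrep_hclose[OF nn nq T A R(2) N tA]) simp
    have c2: "hclose (real i * (\<tau> * (E * (\<tau> * a) * K))) (Rsum (mexp (\<tau> *\<^sub>R A)) \<tau> (zset nq U) i)
        (Ru A (zset nq U) (real i * \<tau>))"
      unfolding E_def
      by (rule Rsum_Ru_hclose[OF A grid(1) convex_zset[OF nq] compact_imp_closed[OF compact_zset[OF nq]]
            zset_nonempty[OF nq] UK grid(2)])
    have "real i * (\<tau> ^ 2 * DV) + real i * (\<tau> * (E * (\<tau> * a) * K))
        = (real i * \<tau>) * (\<tau> * (DV + E * a * K))" by (simp add: power2_eq_square algebra_simps)
    also have "\<dots> \<le> T * (\<tau> * (DV + E * a * K))"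
      using grid DV a K by (intro mult_right_mono) (auto simp: E_def)
    also have "\<dots> = (T * DV + T * (E * a * K)) * \<tau>" by (simp add: algebra_simps)
    finally show "hclose ((T * DV + T * (E * a * K)) * (T / real N)) (Wset nn nq A T N U i)
        (Ru A (zset nq U) (real i * (T / real N)))"
      unfolding \<tau>_def[symmetric] by (rule hclose_mono[OF hclose_trans[OF c1 c2]])
  qed
qed

lemma Union_Lset_hclose:
  fixes np :: "real^'p \<Rightarrow> real" and nq :: "real^'q \<Rightarrow> real" and A :: "real^'n^'n"
  assumes np: "is_norm np" and nq: "is_norm nq" and T: "T > 0"
  obtains D where "0 \<le> D" "\<And>N d. 1 \<le> N \<Longrightarrow> (\<And>i. i \<le> N \<Longrightarrow> hclose (d * (T / real N))
        (Lset nn np nq A T N X0 U i) (Rt A (zset np X0) (zset nq U) (real i * (T / real N)))) \<Longrightarrow>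
      hclose ((d + D) * (T / real N)) (\<Union>i\<in>{0..N}. Lset nn np nq A T N X0 U i) (Rint A (zset np X0) (zset nq U) T)"
proof -
  define a where "a = onorm ((*v) A)"
  obtain R0 where R0: "0 \<le> R0" "\<forall>b\<in>nball np. norm (snd X0 *v b) \<le> R0" by (rule nball_image_bound[OF np])
  obtain R where R: "0 \<le> R" "\<forall>b\<in>nball nq. norm (snd U *v b) \<le> R" by (rule nball_image_bound[OF nq])
  show thesis
  proof (rule that)
    show "0 \<le> a * exp (T * a) * (norm (fst X0) + R0) + exp (T * a) * (norm (fst U) + R)"
      unfolding a_def using R0 R by (simp add: onorm_pos_le)
    fix N d assume N: "1 \<le> N" and L: "\<And>i. i \<le> N \<Longrightarrow> hclose (d * (T / real N))
        (Lset nn np nq A T N X0 U i) (Rt A (zset np X0) (zset nq U) (real i * (T / real N)))"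
    have "hclose (d * (T / real N) + T / real N * (a * exp (T * a) * (norm (fst X0) + R0) + exp (T * a) * (norm (fst U) + R)))
        (\<Union>i\<in>{0..N}. Lset nn np nq A T N X0 U i) (Rint A (zset np X0) (zset nq U) T)"
      unfolding a_def using N R0 R norm_zset_le[OF R0(2)] norm_zset_le[OF R(2)] T
      by (intro Rint_hclose[OF mbound_onorm _ _ _ _ _ _ L]) auto
    then show "hclose ((d + (a * exp (T * a) * (norm (fst X0) + R0) + exp (T * a) * (norm (fst U) + R))) * (T / real N))
        (\<Union>i\<in>{0..N}. Lset nn np nq A T N X0 U i) (Rint A (zset np X0) (zset nq U) T)"
      by (rule hclose_mono) (simp add: algebra_simps)
  qed
qed

theorem theorem2:
  fixes A :: "real^'n^'n" and T :: real
    and X0 :: "(real^'n) \<times> (real^'p^'n)" and U :: "(real^'n) \<times> (real^'q^'n)"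
    and nn :: "real^'n \<Rightarrow> real" and np :: "real^'p \<Rightarrow> real" and nq :: "real^'q \<Rightarrow> real"
  assumes "is_norm nn" and "is_norm np" and "is_norm nq"
    and "T > 0"
    and "rank (snd X0) = CARD('n)" and "rank (snd U) = CARD('n)"
  shows "\<exists>D1 D2 D3 D4. D1 \<ge> 0 \<and> D2 \<ge> 0 \<and> D3 \<ge> 0 \<and> D4 \<ge> 0 \<and>
    (\<forall>N::nat. N \<ge> 1 \<and> T / real N \<in> Iset A \<and> (T / real N) * opnorm nn nn A \<le> 1 \<longrightarrow>
      (\<forall>i\<le>N.
         hausd nn (zset np (Srep nn np A T N X0 i)) (Rh A (zset np X0) (real i * (T / real N)))
           \<le> D1 * (T / real N) \<and>
         hausd nn (Wset nn nq A T N U i) (Ru A (zset nq U) (real i * (T / real N)))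
           \<le> D2 * (T / real N) \<and>
         hausd nn (Lset nn np nq A T N X0 U i) (Rt A (zset np X0) (zset nq U) (real i * (T / real N)))
           \<le> D3 * (T / real N)) \<and>
      hausd nn (\<Union>i\<in>{0..N}. Lset nn np nq A T N X0 U i) (Rint A (zset np X0) (zset nq U) T)
           \<le> D4 * (T / real N))"
proof -
  note nn = assms(1) and np = assms(2) and nq = assms(3) and T = assms(4)
  obtain C where C: "0 \<le> C" "\<And>x. nn x \<le> C * norm x" using is_norm_le_norm[OF nn] by blast
  obtain D1 where D1: "0 \<le> D1" "\<And>N i. 1 \<le> N \<Longrightarrow> i \<le> N \<Longrightarrow>
      hclose (D1 * (T / real N)) (zset np (Srep nn np A T N X0 i)) (Rh A (zset np X0) (real i * (T / real N)))"
    using Srep_hclose[OF nn np T] by blast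
  obtain D2 where D2: "0 \<le> D2" "\<And>N i. 1 \<le> N \<Longrightarrow> T / real N * opnorm nn nn A \<le> 1 \<Longrightarrow> i \<le> N \<Longrightarrow>
      hclose (D2 * (T / real N)) (Wset nn nq A T N U i) (Ru A (zset nq U) (real i * (T / real N)))"
    using Wset_hclose[OF nn nq T] by blast
  obtain D where D: "0 \<le> D" "\<And>N d. 1 \<le> N \<Longrightarrow> (\<And>i. i \<le> N \<Longrightarrow> hclose (d * (T / real N))
        (Lset nn np nq A T N X0 U i) (Rt A (zset np X0) (zset nq U) (real i * (T / real N)))) \<Longrightarrow>
      hclose ((d + D) * (T / real N)) (\<Union>i\<in>{0..N}. Lset nn np nq A T N X0 U i) (Rint A (zset np X0) (zset nq U) T)"
    using Union_Lset_hclose[OF np nq T] by blast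
  have L: "hclose ((D1 + D2) * (T / real N)) (Lset nn np nq A T N X0 U i)
      (Rt A (zset np X0) (zset nq U) (real i * (T / real N)))"
    if "1 \<le> N" "T / real N * opnorm nn nn A \<le> 1" "i \<le> N" for N i
    unfolding Lset_def Rt_def distrib_right using D1(2) D2(2) that by (intro hclose_msum)
  have hausd: "hausd nn X Y \<le> (C * D') * (T / real N)" if "hclose (D' * (T / real N)) X Y" "0 \<le> D'" "1 \<le> N"
    for X Y D' N
    using hausd_le_hclose[OF nn C _ that(1)] that(2,3) T by (simp add: mult.assoc)
  show ?thesis
    using D1 D2 D C L
    by (intro exI[of _ "C * D1"] exI[of _ "C * D2"] exI[of _ "C * (D1 + D2)"] exI[of _ "C * (D1 + D2 + D)"]
        conjI allI impI hausd) auto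
qed

end
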